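(* For every integer $t>1$ there exists $n_0$ such that for all $n\ge n_0$, $$\mathrm{ex}_3(n,F_t^3)=\binom{n}{3}-\binom{n-t}{3}.$$
   Context: For an $r$-uniform hypergraph ($r$-graph) $\mathcal F$, $\mathrm{ex}_r(n,\mathcal F)$ denotes the maximum number of hyperedges in an $n$-vertex $r$-graph that does not contain $\mathcal F$ as a subhypergraph. The $t$-fan $F_t$ is the graph on $2t+1$ vertices consisting of $t$ triangles which pairwise intersect in exactly one common vertex (the center). For a graph $F$, its $r$-expansion $F^r$ is the $r$-graph obtained from $F$ by adding to each edge of $F$ a set of $r-2$ new vertices, where all $(r-2)|E(F)|$ new vertices are distinct from each other and from $V(F)$; each edge together with its new vertices becomes a hyperedge. Thus $F_t^3$ is a 3-graph with $5t+1$ vertices and $3t$ hyperedges. *)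

theory Defs
  imports Main
begin

text \<open>An r-graph is a set of r-element subsets (hyperedges) of a vertex set.
  A hypergraph H contains F (as a subhypergraph) if there is an injective map
  from the vertices of F (which have no isolated vertices here, so V(F) is the
  union of its edges) into the vertices of H sending hyperedges to hyperedges.\<close>

definition contains :: "nat set set \<Rightarrow> 'b set set \<Rightarrow> bool" where
  "contains H F \<longleftrightarrow> (\<exists>f. inj_on f (\<Union>F) \<and> (\<forall>e\<in>F. f ` e \<in> H))"

definition rgraphs :: "nat \<Rightarrow> nat \<Rightarrow> nat set set set" where
  "rgraphs r n = {H. \<forall>e\<in>H. e \<subseteq> {..<n} \<and> card e = r}"

definition ex :: "nat \<Rightarrow> nat \<Rightarrow> 'b set set \<Rightarrow> nat" where
  "ex r n F = Max {card H | H. H \<in> rgraphs r n \<and> \<not> contains H F}"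

text \<open>r-expansion of a graph given by its edge set E (a set of 2-element sets):
  each edge e gets r-2 new vertices Inr (e, j), j < r-2.\<close>
definition expansion :: "nat \<Rightarrow> 'a set set \<Rightarrow> ('a + 'a set \<times> nat) set set" where
  "expansion r E = {Inl ` e \<union> (\<lambda>j. Inr (e, j)) ` {..<r-2} | e. e \<in> E}"

definition fan :: "nat \<Rightarrow> nat set set" where
  "fan t = (\<Union>i<t. {{0, 2*i+1}, {0, 2*i+2}, {2*i+1, 2*i+2}})"

end

theory Submission
  imports Defs
begin

text \<open>
  Let \<open>H\<close> be a 3-graph without the expanded fan.  Each edge is distributed over its three pairs, a pair of codegree
  \<open>c\<close> receiving at most \<open>1\<close>, \<open>1/2\<close>, \<open>1/3\<close> or \<open>0\<close> of it according to whether \<open>c \<le> t\<close>, \<open>c \<le> 2t\<close>, \<open>c \<le> 3t\<close> or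
  \<open>c > 3t\<close>; hence no pair receives more than \<open>t\<close>.  The edges that cannot be distributed have codegrees exceeding
  \<open>t\<close>, \<open>2t\<close>, \<open>3t\<close>.  A large matching of such edges in the link of a vertex would extend greedily to a fan, so every
  such link has a bounded cover and there are only \<open>O(n)\<close> of these edges.

  Consequently, if \<open>H\<close> has at least \<open>(n choose 3) - (n - t choose 3) = t n\<^sup>2/2 - O(n)\<close> edges, then all but \<open>O(n)\<close> pairs
  receive exactly \<open>t\<close> (they are called tight).  Two tight pairs in one edge have codegree at least \<open>2t\<close>, and \<open>2t - 2 \<ge> t\<close>
  leaves room to embed a fan if this happens too often at one vertex.  Otherwise the neighbourhoods of tight pairs
  consist of a few vertices of large codegree, and pigeonholing produces a set \<open>T\<close> of size \<open>t\<close> and a linear-size set \<open>A\<close>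
  all of whose pairs have neighbourhood exactly \<open>T\<close>.

  All but boundedly many vertices then have large codegree with each \<open>s \<in> T\<close>, and an edge disjoint from \<open>T\<close> must contain
  two exceptional vertices for every \<open>s\<close>.  An exceptional vertex costs about \<open>t n\<close> edges meeting \<open>T\<close>, but contributes
  to at most about \<open>(2t - 1) n\<close> edges disjoint from \<open>T\<close>, each shared by two exceptional vertices; so exceptional
  vertices never pay off.
\<close>

section \<open>Systems of representatives, independent sets and matchings\<close>

text \<open>Representatives are chosen in order of increasing list size: when the turn of
  \<open>j\<close> comes, fewer than \<open>card (L j)\<close> values are taken. The induction
  therefore splits off an index with a longest list. The graded condition is made for the thresholds
  \<open>t\<close>, \<open>2 * t\<close>, \<open>3 * t\<close>.\<close>

lemma greedy_sdr:
  fixes L :: "'j \<Rightarrow> 'a set"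
  assumes "finite J" "\<And>j. j \<in> J \<Longrightarrow> finite (L j)"
    and "\<And>j. j \<in> J \<Longrightarrow> card {i \<in> J. card (L i) \<le> card (L j)} \<le> card (L j)"
  shows "\<exists>f. inj_on f J \<and> (\<forall>j\<in>J. f j \<in> L j)"
  using assms
proof (induction "card J" arbitrary: J)
  case 0
  then show ?case by auto
next
  case (Suc m)
  then have "J \<noteq> {}" by auto
  then have "Max ((\<lambda>j. card (L j)) ` J) \<in> (\<lambda>j. card (L j)) ` J"
    using Suc.prems(1) by simp
  then obtain j where j: "j \<in> J" "Max ((\<lambda>j. card (L j)) ` J) = card (L j)" by blast
  have jmax: "card (L i) \<le> card (L j)" if "i \<in> J" for i
    unfolding j(2)[symmetric] using that Suc.prems(1) by simp
  have "\<exists>f. inj_on f (J - {j}) \<and> (\<forall>i\<in>J - {j}. f i \<in> L i)"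
  proof (rule Suc.hyps(1))
    show "m = card (J - {j})" using Suc.hyps(2) j(1) by simp
    fix i assume i: "i \<in> J - {j}"
    have "card {k \<in> J - {j}. card (L k) \<le> card (L i)} \<le> card {k \<in> J. card (L k) \<le> card (L i)}"
      by (rule card_mono) (use Suc.prems(1) in auto)
    then show "card {k \<in> J - {j}. card (L k) \<le> card (L i)} \<le> card (L i)"
      using Suc.prems(3)[of i] i by auto
  qed (use Suc.prems in auto)
  then obtain f where f: "inj_on f (J - {j})" "\<forall>i\<in>J - {j}. f i \<in> L i" by blast
  have "card (f ` (J - {j})) = m"
    using card_image[OF f(1)] Suc.hyps(2) j(1) by simp
  moreover have "{i \<in> J. card (L i) \<le> card (L j)} = J" using jmax by auto
  then have "Suc m \<le> card (L j)" using Suc.prems(3)[OF j(1)] Suc.hyps(2) by simp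
  ultimately have "\<not> L j \<subseteq> f ` (J - {j})"
    using card_mono[of "f ` (J - {j})" "L j"] Suc.prems(1) by auto
  then obtain w where w: "w \<in> L j" "w \<notin> f ` (J - {j})" by blast
  have "inj_on (f(j := w)) J"
  proof (rule inj_onI)
    fix a b assume "a \<in> J" "b \<in> J" "(f(j := w)) a = (f(j := w)) b"
    then show "a = b" using w(2) f(1) by (auto simp: inj_on_def split: if_splits)
  qed
  moreover have "\<forall>i\<in>J. (f(j := w)) i \<in> L i" using f(2) w(1) by auto
  ultimately show ?case by blast
qed

lemma uniform_sdr:
  fixes L :: "'j \<Rightarrow> 'a set"
  assumes "finite J" "\<And>j. j \<in> J \<Longrightarrow> finite (L j)" "\<And>j. j \<in> J \<Longrightarrow> card J \<le> card (L j)"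
  obtains f where "inj_on f J" "\<And>j. j \<in> J \<Longrightarrow> f j \<in> L j"
proof -
  have "\<exists>f. inj_on f J \<and> (\<forall>j\<in>J. f j \<in> L j)"
  proof (rule greedy_sdr[OF assms(1,2)])
    fix j assume "j \<in> J"
    have "card {i \<in> J. card (L i) \<le> card (L j)} \<le> card J"
      by (rule card_mono) (use assms(1) in auto)
    then show "card {i \<in> J. card (L i) \<le> card (L j)} \<le> card (L j)"
      using assms(3)[OF \<open>j \<in> J\<close>] by simp
  qed auto
  then show ?thesis using that by blast
qed

text \<open>Double counting: in-degrees and out-degrees of \<open>R\<close> on \<open>I\<close> have
  the same average.\<close>

lemma ex_small_indegree:
  assumes "finite I" "I \<noteq> {}" "\<And>u. u \<in> I \<Longrightarrow> card {v \<in> I. R u v} \<le> b"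
  shows "\<exists>v\<in>I. card {u \<in> I. R u v} \<le> b"
proof (rule ccontr)
  assume "\<not> ?thesis"
  then have *: "Suc b \<le> card {u \<in> I. R u v}" if "v \<in> I" for v using that by force
  have "(\<Sum>u\<in>I. card {v \<in> I. R u v}) = (\<Sum>v\<in>I. card {u \<in> I. R u v})"
    by (rule sum_multicount_gen) (use assms(1) in auto)
  moreover have "(\<Sum>u\<in>I. card {v \<in> I. R u v}) \<le> card I * b"
    using sum_bounded_above[of I "\<lambda>u. card {v \<in> I. R u v}" b] assms(3) by simp
  moreover have "card I * Suc b \<le> (\<Sum>v\<in>I. card {u \<in> I. R u v})"
    using sum_bounded_below[of I "Suc b" "\<lambda>v. card {u \<in> I. R u v}"] * by simp
  moreover have "card I > 0" using assms by (simp add: card_gt_0_iff)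
  ultimately show False by simp
qed

text \<open>\<open>R\<close> is a directed conflict relation of bounded out-degree. A vertex of
  small in-degree is chosen and deleted together with its at most \<open>2 * b\<close> in- and
  out-neighbours, so each chosen vertex costs \<open>2 * b + 1\<close>.\<close>

lemma select_independent:
  assumes "finite I" "\<And>u. u \<in> I \<Longrightarrow> card {v \<in> I. R u v} \<le> b" "m * (2 * b + 1) \<le> card I"
  shows "\<exists>J\<subseteq>I. card J = m \<and> (\<forall>i\<in>J. \<forall>j\<in>J. i \<noteq> j \<longrightarrow> \<not> R i j)"
  using assms
proof (induction m arbitrary: I)
  case 0
  then show ?case by (intro exI[of _ "{}"]) auto
next
  case (Suc m)
  have "I \<noteq> {}" using Suc.prems(3) by auto
  then obtain v where v: "v \<in> I" "card {u \<in> I. R u v} \<le> b"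
    using ex_small_indegree[of I R b] Suc.prems(1,2) by blast
  define X where "X = {v} \<union> {u \<in> I. R u v} \<union> {u \<in> I. R v u}"
  have "card X \<le> card {v} + card {u \<in> I. R u v} + card {u \<in> I. R v u}"
    unfolding X_def by (meson card_Un_le le_trans add_le_mono1)
  also have "\<dots> \<le> 2 * b + 1" using v(2) Suc.prems(2)[OF v(1)] by simp
  finally have X: "card X \<le> 2 * b + 1" .
  have "\<exists>J\<subseteq>I - X. card J = m \<and> (\<forall>i\<in>J. \<forall>j\<in>J. i \<noteq> j \<longrightarrow> \<not> R i j)"
  proof (rule Suc.IH)
    show "card {w \<in> I - X. R u w} \<le> b" if "u \<in> I - X" for u
    proof -
      have "card {w \<in> I - X. R u w} \<le> card {w \<in> I. R u w}"
        by (rule card_mono) (use Suc.prems(1) in auto)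
      then show ?thesis using Suc.prems(2)[of u] that by auto
    qed
    have "card I - card X \<le> card (I - X)" by (rule diff_card_le_card_Diff) (auto simp: X_def Suc.prems(1))
    then show "m * (2 * b + 1) \<le> card (I - X)" using X Suc.prems(3) by simp
  qed (use Suc.prems in auto)
  then obtain J where J: "J \<subseteq> I - X" "card J = m" "\<forall>i\<in>J. \<forall>j\<in>J. i \<noteq> j \<longrightarrow> \<not> R i j" by blast
  have "finite J" using J(1) Suc.prems(1) finite_subset by blast
  moreover have "v \<notin> J" using J(1) by (auto simp: X_def)
  ultimately have "card (insert v J) = Suc m" using J(2) by simp
  moreover have "insert v J \<subseteq> I" using J(1) v(1) by auto
  moreover have "\<forall>i\<in>insert v J. \<forall>j\<in>insert v J. i \<noteq> j \<longrightarrow> \<not> R i j"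
    using J(1,3) by (auto simp: X_def)
  ultimately show ?case by blast
qed

text \<open>Only the average out-degree is bounded here. By Markov's inequality at least half of
  \<open>I\<close> has out-degree at most \<open>2 * b\<close>, and
  \<open>select_independent\<close> applies to that half.\<close>

lemma select_sparse:
  assumes "finite I" "card {(u, v) \<in> I \<times> I. R u v} \<le> b * card I" "2 * m * (4 * b + 1) \<le> card I"
  shows "\<exists>J\<subseteq>I. card J = m \<and> (\<forall>i\<in>J. \<forall>j\<in>J. i \<noteq> j \<longrightarrow> \<not> R i j)"
proof -
  define I' where "I' = {u \<in> I. card {v \<in> I. R u v} \<le> 2 * b}"
  have fin: "finite I'" using assms(1) by (simp add: I'_def)
  have "{(u, v) \<in> I \<times> I. R u v} = Sigma I (\<lambda>u. {v \<in> I. R u v})" by auto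
  then have "card {(u, v) \<in> I \<times> I. R u v} = (\<Sum>u\<in>I. card {v \<in> I. R u v})"
    using assms(1) by simp
  moreover have "(\<Sum>u\<in>I - I'. card {v \<in> I. R u v}) \<le> (\<Sum>u\<in>I. card {v \<in> I. R u v})"
    by (rule sum_mono2) (use assms(1) in auto)
  moreover have "2 * b + 1 \<le> card {v \<in> I. R u v}" if "u \<in> I - I'" for u
    using that by (auto simp: I'_def)
  then have "card (I - I') * (2 * b + 1) \<le> (\<Sum>u\<in>I - I'. card {v \<in> I. R u v})"
    using sum_bounded_below[of "I - I'" "2 * b + 1" "\<lambda>u. card {v \<in> I. R u v}"] by simp
  ultimately have "card (I - I') * (2 * b + 1) \<le> b * card I" using assms(2) by linarith
  then have "(2 * card (I - I')) * (2 * b + 1) \<le> card I * (2 * b + 1)" by (simp add: algebra_simps)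
  then have "2 * card (I - I') \<le> card I" 
    by (metis Suc_eq_plus1 mult_le_cancel2 zero_less_Suc)
  moreover have "card I = card (I - I') + card I'"
    using card_Diff_subset[of I' I] fin assms(1) card_mono[of I I'] by (auto simp: I'_def)
  ultimately have c: "card I \<le> 2 * card I'" by linarith
  have "\<exists>J\<subseteq>I'. card J = m \<and> (\<forall>i\<in>J. \<forall>j\<in>J. i \<noteq> j \<longrightarrow> \<not> R i j)"
  proof (rule select_independent[where b = "2 * b"])
    show "card {v \<in> I'. R u v} \<le> 2 * b" if "u \<in> I'" for u
    proof -
      have "card {v \<in> I'. R u v} \<le> card {v \<in> I. R u v}"
        by (rule card_mono) (use assms(1) in \<open>auto simp: I'_def\<close>)
      then show ?thesis using that by (auto simp: I'_def)
    qed
    show "m * (2 * (2 * b) + 1) \<le> card I'" using c assms(3) by simp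
  qed (rule fin)
  then show ?thesis by (auto simp: I'_def)
qed

text \<open>The vertex set of a maximal matching is a vertex cover; bounds on matchings thus become
  bounds on covers.\<close>

lemma maximal_matching:
  assumes "finite G"
  shows "\<exists>M\<subseteq>G. pairwise disjnt M \<and> (\<forall>e\<in>G. e \<noteq> {} \<longrightarrow> e \<inter> \<Union>M \<noteq> {})"
proof -
  let ?F = "{M. M \<subseteq> G \<and> pairwise disjnt M}"
  have "finite ?F" using assms by simp
  moreover have "{} \<in> ?F" by simp
  then have "?F \<noteq> {}" by (rule ex_in_conv[THEN iffD1, OF exI])
  ultimately have "\<exists>M\<in>?F. \<forall>M'\<in>?F. M \<subseteq> M' \<longrightarrow> M = M'" by (rule finite_has_maximal)
  then obtain M where M: "M \<in> ?F" "\<forall>M'\<in>?F. M \<subseteq> M' \<longrightarrow> M = M'" ..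
  have "e \<inter> \<Union>M \<noteq> {}" if e: "e \<in> G" "e \<noteq> {}" for e
  proof
    assume *: "e \<inter> \<Union>M = {}"
    have M1: "M \<subseteq> G" "pairwise disjnt M" using M(1) by simp_all
    have "disjnt e f \<and> disjnt f e" if "f \<in> M" for f
      unfolding disjnt_def using * that by blast
    then have "pairwise disjnt (insert e M)" using M1(2) by (simp add: pairwise_insert)
    then have "insert e M \<in> ?F" using M1(1) e(1) by simp
    from M(2)[THEN bspec, OF this] have "M = insert e M" by (simp add: subset_insertI)
    then show False using * e(2) by auto
  qed
  moreover have "M \<subseteq> G" "pairwise disjnt M" using M(1) by simp_all
  ultimately show ?thesis by metis
qed

lemma pigeonhole_fibre:
  assumes "finite A" "A \<noteq> {}" "finite B" "f ` A \<subseteq> B"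
  shows "\<exists>y\<in>B. card A \<le> card B * card {a \<in> A. f a = y}"
proof (rule ccontr)
  assume "\<not> ?thesis"
  then have *: "card B * card {a \<in> A. f a = y} < card A" if "y \<in> B" for y using that by force
  have "B \<noteq> {}" using assms by auto
  have "A = (\<Union>y\<in>B. {a \<in> A. f a = y})" using assms(4) by auto
  then have "card A \<le> (\<Sum>y\<in>B. card {a \<in> A. f a = y})"
    using card_UN_le[OF assms(3), of "\<lambda>y. {a \<in> A. f a = y}"] by simp
  then have "card B * card A \<le> (\<Sum>y\<in>B. card B * card {a \<in> A. f a = y})"
    by (simp add: sum_distrib_left[symmetric])
  also have "\<dots> < (\<Sum>y\<in>B. card A)"
    by (rule sum_strict_mono) (use assms(3) \<open>B \<noteq> {}\<close> * in auto)
  finally show False by simp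
qed

section \<open>Embedding the expanded fan\<close>

lemma expansion_fan:
  "expansion 3 (fan t) = (\<Union>i<t. {{Inl 0, Inl (2 * i + 1), Inr ({0, 2 * i + 1}, 0)},
      {Inl 0, Inl (2 * i + 2), Inr ({0, 2 * i + 2}, 0)},
      {Inl (2 * i + 1), Inl (2 * i + 2), Inr ({2 * i + 1, 2 * i + 2}, 0)}})"
proof -
  have "{..<3 - 2} = {0::nat}" by auto
  then have "expansion 3 E = (\<lambda>e. Inl ` e \<union> {Inr (e, 0)}) ` E" for E :: "nat set set"
    unfolding expansion_def by auto
  then show ?thesis
    unfolding fan_def by (simp only: image_UN image_insert image_empty Un_insert_left Un_empty_left)
qed

text \<open>\<open>v\<close> is the centre, \<open>p i\<close> and \<open>q i\<close> are the other
  vertices of triangle \<open>i\<close>, and \<open>x i\<close>, \<open>y i\<close>,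
  \<open>z i\<close> expand its edges \<open>v p\<close>, \<open>v q\<close> and \<open>p q\<close>.
  With an arbitrary index set \<open>I\<close>, triangles can be indexed by whatever they were
  selected from.\<close>

lemma contains_fanI:
  assumes I: "finite I" "card I = t"
    and dist: "\<And>i. i \<in> I \<Longrightarrow> distinct [v, p i, q i, x i, y i, z i]"
    and disj: "\<And>i j. i \<in> I \<Longrightarrow> j \<in> I \<Longrightarrow> i \<noteq> j \<Longrightarrow>
      {p i, q i, x i, y i, z i} \<inter> {p j, q j, x j, y j, z j} = {}"
    and edges: "\<And>i. i \<in> I \<Longrightarrow> {v, p i, x i} \<in> H" "\<And>i. i \<in> I \<Longrightarrow> {v, q i, y i} \<in> H"
      "\<And>i. i \<in> I \<Longrightarrow> {p i, q i, z i} \<in> H"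
  shows "contains H (expansion 3 (fan t))"
proof -
  obtain h where h: "bij_betw h {..<t} I" using ex_bij_betw_nat_finite[OF I(1)] I(2)
    by (metis atLeast0LessThan)
  have hI: "h i \<in> I" if "i < t" for i using h that by (auto simp: bij_betw_def)
  have hinj: "h i \<noteq> h j" if "i < t" "j < t" "i \<noteq> j" for i j
    using h that by (auto simp: bij_betw_def inj_on_def)
  \<comment> \<open>The triangle number is decoded from a vertex \<open>m\<close> as
    \<open>(m - 1) div 2\<close>, and from an expansion vertex through the larger end of its edge.
    Parity separates \<open>p\<close> from \<open>q\<close> and \<open>x\<close> from
    \<open>y\<close>; containing 0 separates spokes from outer edges.\<close>
  define f :: "nat + nat set \<times> nat \<Rightarrow> nat" where
    "f = case_sum (\<lambda>m. if m = 0 then v else if odd m then p (h ((m - 1) div 2)) else q (h ((m - 1) div 2)))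
       (\<lambda>(e, j). if 0 \<in> e then (if odd (Max e) then x (h ((Max e - 1) div 2)) else y (h ((Max e - 1) div 2)))
          else z (h ((Max e - 1) div 2)))"
  have f0: "f (Inl 0) = v" by (simp add: f_def)
  have f1: "f (Inl (2 * i + 1)) = p (h i)" "f (Inl (2 * i + 2)) = q (h i)"
    "f (Inr ({0, 2 * i + 1}, 0)) = x (h i)" "f (Inr ({0, 2 * i + 2}, 0)) = y (h i)"
    "f (Inr ({2 * i + 1, 2 * i + 2}, 0)) = z (h i)" for i
    by (simp_all add: f_def)
  define B :: "nat \<Rightarrow> (nat + nat set \<times> nat) set" where
    "B i = {Inl (2 * i + 1), Inl (2 * i + 2), Inr ({0, 2 * i + 1}, 0), Inr ({0, 2 * i + 2}, 0),
      Inr ({2 * i + 1, 2 * i + 2}, 0)}" for i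
  have dom: "\<Union>(expansion 3 (fan t)) \<subseteq> insert (Inl 0) (\<Union>i<t. B i)"
    unfolding expansion_fan B_def by auto
  have fB: "f ` B i = {p (h i), q (h i), x (h i), y (h i), z (h i)}" for i
    unfolding B_def by (simp only: image_insert image_empty f1)
  have injB: "inj_on f (B i)" if "i < t" for i
  proof (rule eq_card_imp_inj_on)
    have "card (f ` B i) = 5" unfolding fB using dist[OF hI[OF that]] by simp
    moreover have "card (B i) \<le> 5" unfolding B_def by (simp add: card_insert_if)
    ultimately show "card (f ` B i) = card (B i)" using card_image_le[of "B i" f] by (simp add: B_def)
  qed (simp add: B_def)
  have vB: "v \<notin> f ` B i" if "i < t" for i
    unfolding fB using dist[OF hI[OF that]] by simp
  have "inj_on f (\<Union>i<t. B i)"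
  proof (rule inj_onI)
    fix a b assume a: "a \<in> (\<Union>i<t. B i)" and b: "b \<in> (\<Union>i<t. B i)" and eq: "f a = f b"
    obtain i where i: "i < t" "a \<in> B i" using a by blast
    obtain j where j: "j < t" "b \<in> B j" using b by blast
    have "f a \<in> f ` B i \<inter> f ` B j" 
      using imageI[OF i(2), of f] imageI[OF j(2), of f] eq by simp
    moreover have "f ` B i \<inter> f ` B j = {}" if "i \<noteq> j"
      unfolding fB by (rule disj[OF hI[OF i(1)] hI[OF j(1)] hinj[OF i(1) j(1) that]])
    ultimately have "i = j" by blast
    then show "a = b" using injB[OF i(1)] i(2) j(2) eq by (auto dest: inj_onD)
  qed
  then have "inj_on f (insert (Inl 0) (\<Union>i<t. B i))"
    using vB f0 by (auto simp: inj_on_insert)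
  then have "inj_on f (\<Union>(expansion 3 (fan t)))" by (rule inj_on_subset[OF _ dom])
  moreover have "\<forall>E\<in>expansion 3 (fan t). f ` E \<in> H"
  proof
    fix E assume "E \<in> expansion 3 (fan t)"
    then obtain i where i: "i < t" and E: "E \<in> {{Inl 0, Inl (2 * i + 1), Inr ({0, 2 * i + 1}, 0)},
      {Inl 0, Inl (2 * i + 2), Inr ({0, 2 * i + 2}, 0)},
      {Inl (2 * i + 1), Inl (2 * i + 2), Inr ({2 * i + 1, 2 * i + 2}, 0)}}"
      unfolding expansion_fan by blast
    have "f ` E \<in> {{v, p (h i), x (h i)}, {v, q (h i), y (h i)}, {p (h i), q (h i), z (h i)}}"
      using E by (elim insertE emptyE) (simp_all only: image_insert image_empty f0 f1 insert_iff simp_thms)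
    then show "f ` E \<in> H" using edges[OF hI[OF i]] by auto
  qed
  ultimately show ?thesis unfolding contains_def by (intro exI conjI)
qed

section \<open>Neighbourhoods of pairs and greedy embeddings of the fan\<close>

definition nbrs :: "nat set set \<Rightarrow> nat set \<Rightarrow> nat set" where
  "nbrs H P = {w. w \<notin> P \<and> insert w P \<in> H}"

locale fan_free =
  fixes H :: "nat set set" and n t :: nat
  assumes t2: "2 \<le> t" and H: "H \<in> rgraphs 3 n" and free: "\<not> contains H (expansion 3 (fan t))"
begin

lemma edgeD: "e \<in> H \<Longrightarrow> e \<subseteq> {..<n}" "e \<in> H \<Longrightarrow> card e = 3"
  using H by (auto simp: rgraphs_def)

lemma finite_H: "finite H"
  by (rule finite_subset[of _ "Pow {..<n}"]) (use edgeD(1) in auto)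

lemma nbrs_sub: "nbrs H P \<subseteq> {..<n}"
  using edgeD(1) by (auto simp: nbrs_def)

lemma finite_nbrs: "finite (nbrs H P)"
  using nbrs_sub finite_subset by blast

lemma edge_distinct: "{a, b, c} \<in> H \<Longrightarrow> a \<noteq> b \<and> a \<noteq> c \<and> b \<noteq> c"
  using edgeD(2)[of "{a, b, c}"] by (auto simp: card_insert_if split: if_splits)

lemma edge_less: "{a, b, c} \<in> H \<Longrightarrow> a < n \<and> b < n \<and> c < n"
  using edgeD(1)[of "{a, b, c}"] by auto

lemma in_nbrs: "c \<in> nbrs H {a, b} \<longleftrightarrow> {a, b, c} \<in> H"
  using edge_distinct[of a b c] by (auto simp: nbrs_def insert_commute)

lemma edge_nbrs: "{a, b, c} \<in> H \<Longrightarrow> c \<in> nbrs H {a, b} \<and> b \<in> nbrs H {a, c} \<and> a \<in> nbrs H {b, c}"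
  by (simp add: in_nbrs insert_commute)

text \<open>The codegrees at the centre are so large that the edges through the centre can be chosen last.\<close>
lemma no_fan_rich_centre:
  assumes I: "finite I" "card I = t"
    and dist: "\<And>i. i \<in> I \<Longrightarrow> distinct [v, p i, q i, z i]"
    and disj: "\<And>i j. i \<in> I \<Longrightarrow> j \<in> I \<Longrightarrow> i \<noteq> j \<Longrightarrow> {p i, q i, z i} \<inter> {p j, q j, z j} = {}"
    and edges: "\<And>i. i \<in> I \<Longrightarrow> {p i, q i, z i} \<in> H"
    and rich: "\<And>i. i \<in> I \<Longrightarrow> 5 * t + 1 \<le> card (nbrs H {v, p i})"
      "\<And>i. i \<in> I \<Longrightarrow> 5 * t + 1 \<le> card (nbrs H {v, q i})"
  shows False
proof -
  define U where "U = insert v (\<Union>i\<in>I. {p i, q i, z i})"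
  have finU: "finite U" using I by (simp add: U_def)
  have "card (\<Union>i\<in>I. {p i, q i, z i}) \<le> (\<Sum>i\<in>I. card {p i, q i, z i})"
    by (rule card_UN_le[OF I(1)])
  also have "\<dots> \<le> (\<Sum>i\<in>I. 3)" by (rule sum_mono) (simp add: card_insert_if)
  finally have cU: "card U \<le> 3 * t + 1" using I
    by (simp add: U_def card_insert_if finU)
  \<comment> \<open>The boolean selects the spoke to \<open>p i\<close> or to \<open>q i\<close>.
    Deleting \<open>U\<close>, which has at most \<open>3 * t + 1\<close> vertices, leaves
    \<open>2 * t\<close> candidates for each of the \<open>2 * t\<close> spokes.\<close>
  define L where "L = (\<lambda>(i, b). nbrs H {v, if b then p i else q i} - U)"
  have big: "2 * t \<le> card (L (i, b))" if "i \<in> I" for i b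
  proof -
    have "card (nbrs H {v, if b then p i else q i}) - card U \<le> card (L (i, b))"
      unfolding L_def by (simp add: diff_card_le_card_Diff finU)
    then show ?thesis using rich[OF that] cU by (cases b) auto
  qed
  obtain g where g: "inj_on g (I \<times> (UNIV :: bool set))"
      "\<And>j. j \<in> I \<times> (UNIV :: bool set) \<Longrightarrow> g j \<in> L j"
  proof (rule uniform_sdr[of "I \<times> (UNIV :: bool set)" L])
    show "card (I \<times> (UNIV :: bool set)) \<le> card (L j)" if "j \<in> I \<times> UNIV" for j
      using big[of "fst j" "snd j"] that I by (auto simp: card_cartesian_product)
  qed (use I finite_nbrs in \<open>auto simp: L_def\<close>)
  have gT: "g (i, b) \<in> nbrs H {v, if b then p i else q i}" "g (i, b) \<notin> U" if "i \<in> I" for i b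
    using g(2)[of "(i, b)"] that by (auto simp: L_def)
  have gU: "g (i, b) \<noteq> v" "g (i, b) \<noteq> p j" "g (i, b) \<noteq> q j" "g (i, b) \<noteq> z j" if "i \<in> I" "j \<in> I" for i j b
    using gT(2)[OF that(1), of b] that(2) unfolding U_def by auto
  have gi: "g (i, b) \<noteq> g (j, c)" if "i \<in> I" "j \<in> I" "(i, b) \<noteq> (j, c)" for i j b c
    using inj_onD[OF g(1), of "(i, b)" "(j, c)"] that by auto
  have "contains H (expansion 3 (fan t))"
  proof (rule contains_fanI[OF I, where v = v and p = p and q = q and z = z
        and x = "\<lambda>i. g (i, True)" and y = "\<lambda>i. g (i, False)"])
    fix i assume i: "i \<in> I"
    show "distinct [v, p i, q i, g (i, True), g (i, False), z i]"
      using dist[OF i] gU[OF i i] gi[OF i i, of True False] by (auto simp: eq_commute)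
    show "{v, p i, g (i, True)} \<in> H" using gT(1)[OF i, of True] by (simp add: in_nbrs)
    show "{v, q i, g (i, False)} \<in> H" using gT(1)[OF i, of False] by (simp add: in_nbrs)
    show "{p i, q i, z i} \<in> H" by (rule edges[OF i])
  next
    fix i j assume ij: "i \<in> I" "j \<in> I" "i \<noteq> j"
    show "{p i, q i, g (i, True), g (i, False), z i} \<inter> {p j, q j, g (j, True), g (j, False), z j} = {}"
      using disj[OF ij] gU[OF ij(1,2)] gU[OF ij(2,1)] gi[OF ij(1,2)] ij(3) by (auto simp: eq_commute)
  qed
  then show False using free by simp
qed

text \<open>The outer edges are picked first, from lists of size \<open>t\<close>; the last
  condition on \<open>Z\<close> keeps the picked vertices out of the other triangles. The spokes
  follow by \<open>no_fan_rich_centre\<close>.\<close>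

lemma no_fan_rich_centre_lists:
  assumes I: "finite I" "card I = t"
    and dist: "\<And>i. i \<in> I \<Longrightarrow> distinct [v, p i, q i]"
    and disj: "\<And>i j. i \<in> I \<Longrightarrow> j \<in> I \<Longrightarrow> i \<noteq> j \<Longrightarrow> {p i, q i} \<inter> {p j, q j} = {}"
    and Z: "\<And>i. i \<in> I \<Longrightarrow> Z i \<subseteq> nbrs H {p i, q i} - {v}" "\<And>i. i \<in> I \<Longrightarrow> t \<le> card (Z i)"
      "\<And>i j. i \<in> I \<Longrightarrow> j \<in> I \<Longrightarrow> i \<noteq> j \<Longrightarrow> Z i \<inter> {p j, q j} = {}"
    and rich: "\<And>i. i \<in> I \<Longrightarrow> 5 * t + 1 \<le> card (nbrs H {v, p i})"
      "\<And>i. i \<in> I \<Longrightarrow> 5 * t + 1 \<le> card (nbrs H {v, q i})"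
  shows False
proof -
  have finZ: "finite (Z i)" if "i \<in> I" for i using Z(1)[OF that] finite_nbrs finite_subset by blast
  obtain z where z: "inj_on z I" "\<And>i. i \<in> I \<Longrightarrow> z i \<in> Z i"
    using uniform_sdr[of I Z] I finZ Z(2) by auto
  have zH: "{p i, q i, z i} \<in> H" "z i \<noteq> v" if "i \<in> I" for i
    using z(2)[OF that] Z(1)[OF that] by (auto simp: in_nbrs)
  show False
  proof (rule no_fan_rich_centre[OF I, where v = v and p = p and q = q and z = z])
    fix i assume i: "i \<in> I"
    show "distinct [v, p i, q i, z i]"
      using dist[OF i] zH[OF i] edge_distinct[OF zH(1)[OF i]] by auto
    show "{p i, q i, z i} \<in> H" by (rule zH(1)[OF i])
  next
    fix i j assume ij: "i \<in> I" "j \<in> I" "i \<noteq> j"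
    have "z i \<noteq> z j" using z(1) ij by (auto dest: inj_onD)
    then show "{p i, q i, z i} \<inter> {p j, q j, z j} = {}"
      using disj[OF ij] Z(3)[OF ij] Z(3)[OF ij(2,1)] ij(3) z(2)[OF ij(1)] z(2)[OF ij(2)] by auto
  qed (use rich in auto)
qed

text \<open>The counterpart without large codegrees at the centre: the spokes are given in advance,
  and the outer edges are picked last, from lists of size \<open>t\<close> avoiding everything
  already placed.\<close>

lemma no_fan_fixed_spokes:
  assumes I: "finite I" "card I = t"
    and dist: "\<And>i. i \<in> I \<Longrightarrow> distinct [v, p i, q i, x i, y i]"
    and disj: "\<And>i j. i \<in> I \<Longrightarrow> j \<in> I \<Longrightarrow> i \<noteq> j \<Longrightarrow> {p i, q i, x i, y i} \<inter> {p j, q j, x j, y j} = {}"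
    and edges: "\<And>i. i \<in> I \<Longrightarrow> {v, p i, x i} \<in> H" "\<And>i. i \<in> I \<Longrightarrow> {v, q i, y i} \<in> H"
    and Z: "\<And>i. i \<in> I \<Longrightarrow> Z i \<subseteq> nbrs H {p i, q i} - {v, x i, y i}" "\<And>i. i \<in> I \<Longrightarrow> t \<le> card (Z i)"
      "\<And>i j. i \<in> I \<Longrightarrow> j \<in> I \<Longrightarrow> i \<noteq> j \<Longrightarrow> Z i \<inter> {p j, q j, x j, y j} = {}"
  shows False
proof -
  have finZ: "finite (Z i)" if "i \<in> I" for i using Z(1)[OF that] finite_nbrs finite_subset by blast
  obtain z where z: "inj_on z I" "\<And>i. i \<in> I \<Longrightarrow> z i \<in> Z i"
    using uniform_sdr[of I Z] I finZ Z(2) by auto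
  have zH: "{p i, q i, z i} \<in> H" "z i \<noteq> v" "z i \<noteq> x i" "z i \<noteq> y i" if "i \<in> I" for i
    using z(2)[OF that] Z(1)[OF that] by (auto simp: in_nbrs)
  have "contains H (expansion 3 (fan t))"
  proof (rule contains_fanI[OF I, where v = v and p = p and q = q and z = z and x = x and y = y])
    fix i assume i: "i \<in> I"
    show "distinct [v, p i, q i, x i, y i, z i]"
      using dist[OF i] zH[OF i] edge_distinct[OF zH(1)[OF i]] by auto
    show "{p i, q i, z i} \<in> H" by (rule zH(1)[OF i])
  next
    fix i j assume ij: "i \<in> I" "j \<in> I" "i \<noteq> j"
    have "z i \<noteq> z j" using z(1) ij by (auto dest: inj_onD)
    then show "{p i, q i, x i, y i, z i} \<inter> {p j, q j, x j, y j, z j} = {}"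
      using disj[OF ij] Z(3)[OF ij] Z(3)[OF ij(2,1)] ij(3) z(2)[OF ij(1)] z(2)[OF ij(2)] by auto
  qed (use edges in auto)
  then show False using free by simp
qed

end

section \<open>Distributing edges over pairs\<close>

text \<open>Each element of \<open>X\<close> lies in at most one body. This turns the size of a
  candidate list into an out-degree bound for \<open>select_independent\<close>.\<close>

lemma card_hits_le:
  assumes "finite X" "\<And>i j. i \<in> I \<Longrightarrow> j \<in> I \<Longrightarrow> i \<noteq> j \<Longrightarrow> body i \<inter> body j = {}"
  shows "card {i \<in> I. X \<inter> body i \<noteq> {}} \<le> card X"
proof -
  have "{i \<in> I. X \<inter> body i \<noteq> {}} \<subseteq> (\<lambda>x. THE i. i \<in> I \<and> x \<in> body i) ` X"
  proof
    fix i assume "i \<in> {i \<in> I. X \<inter> body i \<noteq> {}}"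
    then obtain x where x: "i \<in> I" "x \<in> X" "x \<in> body i" by blast
    have "(THE i. i \<in> I \<and> x \<in> body i) = i"
      by (rule the_equality) (use x assms(2) in blast)+
    then show "i \<in> (\<lambda>x. THE i. i \<in> I \<and> x \<in> body i) ` X"
      by (intro image_eqI[where x = x]) (use x(2) in simp_all)
  qed
  then show ?thesis
    by (rule order_trans[OF card_mono[OF finite_imageI[OF assms(1)]] card_image_le[OF assms(1)]])
qed

definition pairs :: "nat set \<Rightarrow> nat set set" where
  "pairs e = {P. P \<subseteq> e \<and> card P = 2}"

lemma finite_pairs: "finite e \<Longrightarrow> finite (pairs e)"
  unfolding pairs_def by (rule finite_subset[of _ "Pow e"]) auto

lemma card_pairs: "finite e \<Longrightarrow> card (pairs e) = card e choose 2"
  unfolding pairs_def by (rule n_subsets)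

lemma pair_in_pairs: "a \<in> e \<Longrightarrow> b \<in> e \<Longrightarrow> a \<noteq> b \<Longrightarrow> {a, b} \<in> pairs e"
  by (auto simp: pairs_def)

context fan_free
begin

abbreviation cd :: "nat set \<Rightarrow> nat" where "cd P \<equiv> card (nbrs H P)"

lemma finite_edge: "e \<in> H \<Longrightarrow> finite e"
  by (rule card_ge_0_finite) (simp add: edgeD(2))

lemma card_pairs_edge: "e \<in> H \<Longrightarrow> card (pairs e) = 3"
proof -
  assume e: "e \<in> H"
  have "(3::nat) choose 2 = 3" by (simp add: numeral_eq_Suc)
  then show ?thesis using card_pairs[OF finite_edge[OF e]] edgeD(2)[OF e] by simp
qed

lemma card_edges_through: "card P = 2 \<Longrightarrow> card {e \<in> H. P \<subseteq> e} = cd P"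
proof -
  assume P: "card P = 2"
  then have finP: "finite P" using card_ge_0_finite by force
  have "{e \<in> H. P \<subseteq> e} = (\<lambda>w. insert w P) ` nbrs H P"
  proof (intro equalityI subsetI)
    fix e assume e: "e \<in> {e \<in> H. P \<subseteq> e}"
    then have "card (e - P) = 1" using edgeD(2)[of e] P finP by (simp add: card_Diff_subset)
    then obtain w where "e - P = {w}" by (auto simp: card_1_singleton_iff)
    then have "e = insert w P" "w \<notin> P" using e by auto
    then show "e \<in> (\<lambda>w. insert w P) ` nbrs H P" using e by (auto simp: nbrs_def)
  qed (auto simp: nbrs_def)
  moreover have "inj_on (\<lambda>w. insert w P) (nbrs H P)"
    by (auto simp: inj_on_def nbrs_def)
  ultimately show ?thesis by (simp add: card_image)
qed

definition low :: "nat \<Rightarrow> nat set \<Rightarrow> nat set set" where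
  "low j e = {P \<in> pairs e. cd P \<le> j * t}"

text \<open>Weights are measured in sixths of an edge.  Writing \<open>c\<^sub>1 \<le> c\<^sub>2 \<le> c\<^sub>3\<close> for the codegrees of the pairs in
  an edge, the edge is split over the pairs of codegree at most \<open>t\<close> if \<open>c\<^sub>1 \<le> t\<close>, over those of codegree
  at most \<open>2t\<close> if \<open>c\<^sub>2 \<le> 2t\<close>, over all three if \<open>c\<^sub>3 \<le> 3t\<close>.  The remaining edges have codegrees
  exceeding \<open>t\<close>, \<open>2t\<close>, \<open>3t\<close>, which is exactly what a greedy choice of representatives needs.\<close>
definition weight :: "nat set \<Rightarrow> nat set \<Rightarrow> nat" where
  "weight P e = (if low 1 e \<noteq> {} then (if P \<in> low 1 e then 6 div card (low 1 e) else 0)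
     else if 2 \<le> card (low 2 e) then (if P \<in> low 2 e then 6 div card (low 2 e) else 0)
     else if card (low 3 e) = 3 then 2 else 0)"

definition good :: "nat set set" where
  "good = {e \<in> H. low 1 e = {} \<and> card (low 2 e) \<le> 1 \<and> card (low 3 e) \<le> 2}"

definition load :: "nat set \<Rightarrow> nat" where
  "load P = (\<Sum>e\<in>{e \<in> H. P \<subseteq> e}. weight P e)"

text \<open>The most that a pair can receive from a single edge, in sixths. The thresholds are such
  that \<open>cap P * cd P\<close> never exceeds \<open>6 * t\<close>.\<close>

definition cap :: "nat set \<Rightarrow> nat" where
  "cap P = (if cd P \<le> t then 6 else if cd P \<le> 2 * t then 3 else if cd P \<le> 3 * t then 2 else 0)"

lemma low_sub: "low j e \<subseteq> pairs e" by (auto simp: low_def)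

lemma card_low: "e \<in> H \<Longrightarrow> card (low j e) \<le> 3" and finite_low: "e \<in> H \<Longrightarrow> finite (low j e)"
proof -
  assume e: "e \<in> H"
  have "finite (pairs e)" using finite_pairs[OF finite_edge[OF e]] .
  then show "card (low j e) \<le> 3" "finite (low j e)"
    using card_mono[OF _ low_sub[of j e]] card_pairs_edge[OF e] finite_subset[OF low_sub[of j e]] by auto
qed

text \<open>Weight only goes to pairs below the threshold of the branch in force. In the second
  branch at least two pairs share the edge, so each gets at most 3; the third branch requires all
  three pairs to be in \<open>low 3 e\<close>.\<close>

lemma weight_le_cap:
  assumes "e \<in> H" "P \<in> pairs e"
  shows "weight P e \<le> cap P"
proof (cases "low 1 e \<noteq> {}")
  case True
  then show ?thesis by (auto simp: weight_def cap_def low_def)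
next
  case F1: False
  then have cP: "\<not> cd P \<le> t" using assms(2) by (auto simp: low_def)
  show ?thesis
  proof (cases "2 \<le> card (low 2 e)")
    case True
    then have "card (low 2 e) = 2 \<or> card (low 2 e) = 3" using card_low[OF assms(1), of 2] by linarith
    then have "6 div card (low 2 e) \<le> 3" by auto
    then show ?thesis using F1 True cP by (auto simp: weight_def cap_def low_def)
  next
    case F2: False
    show ?thesis
    proof (cases "card (low 3 e) = 3")
      case True
      then have "low 3 e = pairs e"
        using card_subset_eq[OF finite_pairs[OF finite_edge[OF assms(1)]] low_sub] card_pairs_edge[OF assms(1)]
        by simp
      then have "cd P \<le> 3 * t" using assms(2) by (auto simp: low_def)
      then show ?thesis using F1 F2 True cP by (auto simp: weight_def cap_def)
    qed (use F1 F2 in \<open>auto simp: weight_def\<close>)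
  qed
qed

text \<open>Splitting 6 evenly over one, two or three pairs is exact, which is why weights are
  measured in sixths.\<close>

lemma sum_weight:
  assumes "e \<in> H" "e \<notin> good"
  shows "(\<Sum>P\<in>pairs e. weight P e) = 6"
proof -
  have fin: "finite (pairs e)" using finite_pairs[OF finite_edge[OF assms(1)]] .
  have *: "(\<Sum>P\<in>pairs e. if P \<in> low j e then 6 div card (low j e) else 0) = 6" if "low j e \<noteq> {}" for j
  proof -
    have "(\<Sum>P\<in>pairs e. if P \<in> low j e then 6 div card (low j e) else 0)
      = (\<Sum>P\<in>pairs e \<inter> low j e. 6 div card (low j e))"
      by (rule sum.inter_restrict[OF fin, symmetric])
    also have "pairs e \<inter> low j e = low j e" using low_sub by blast
    also have "(\<Sum>P\<in>low j e. 6 div card (low j e)) = card (low j e) * (6 div card (low j e))" by simp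
    finally have sum: "(\<Sum>P\<in>pairs e. if P \<in> low j e then 6 div card (low j e) else 0)
      = card (low j e) * (6 div card (low j e))" .
    have "card (low j e) \<noteq> 0" using that finite_low[OF assms(1)] by simp
    then have "card (low j e) = 1 \<or> card (low j e) = 2 \<or> card (low j e) = 3"
      using card_low[OF assms(1), of j] by linarith
    then have "card (low j e) * (6 div card (low j e)) = 6" by auto
    then show ?thesis unfolding sum .
  qed
  have ng: "\<not> (low 1 e = {} \<and> card (low 2 e) \<le> 1 \<and> card (low 3 e) \<le> 2)"
    using assms by (simp add: good_def)
  show ?thesis
  proof (cases "low 1 e = {}")
    case False
    then show ?thesis using *[OF False] by (simp add: weight_def)
  next
    case F1: True
    show ?thesis
    proof (cases "2 \<le> card (low 2 e)")
      case True
      then have "low 2 e \<noteq> {}" by (intro notI) simp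
      then show ?thesis using *[of 2] F1 True by (simp add: weight_def)
    next
      case False
      then have "card (low 3 e) = 3" using ng F1 card_low[OF assms(1), of 3] by simp
      then show ?thesis using F1 False card_pairs_edge[OF assms(1)] by (simp add: weight_def)
    qed
  qed
qed

lemma cap_cd: "cap P * cd P \<le> 6 * t"
  by (auto simp: cap_def)

lemma through_pairs: "card P = 2 \<Longrightarrow> P \<subseteq> e \<Longrightarrow> P \<in> pairs e"
  by (simp add: pairs_def)

lemma load_le_cap: "card P = 2 \<Longrightarrow> load P \<le> cap P * cd P"
proof -
  assume P: "card P = 2"
  have "load P \<le> (\<Sum>e\<in>{e \<in> H. P \<subseteq> e}. cap P)"
    unfolding load_def by (rule sum_mono) (use weight_le_cap through_pairs[OF P] in auto)
  then show ?thesis using card_edges_through[OF P] by (simp add: mult.commute)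
qed

lemma load_le: "card P = 2 \<Longrightarrow> load P \<le> 6 * t"
  by (rule order_trans[OF load_le_cap cap_cd])

lemma sum_load: "6 * card (H - good) \<le> (\<Sum>P\<in>pairs {..<n}. load P)"
proof -
  have "6 * card (H - good) = (\<Sum>e\<in>H - good. \<Sum>P\<in>pairs e. weight P e)"
    using sum_weight by simp
  also have "\<dots> \<le> (\<Sum>e\<in>H. \<Sum>P\<in>pairs e. weight P e)"
    by (rule sum_mono2) (use finite_H in auto)
  also have "\<dots> = (\<Sum>e\<in>H. \<Sum>P\<in>{P \<in> pairs {..<n}. P \<subseteq> e}. weight P e)"
  proof (rule sum.cong[OF refl])
    fix e assume "e \<in> H"
    then have "pairs e = {P \<in> pairs {..<n}. P \<subseteq> e}" using edgeD(1) by (auto simp: pairs_def)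
    then show "(\<Sum>P\<in>pairs e. weight P e) = (\<Sum>P\<in>{P \<in> pairs {..<n}. P \<subseteq> e}. weight P e)" by simp
  qed
  also have "\<dots> = (\<Sum>P\<in>pairs {..<n}. \<Sum>e\<in>{e \<in> H. P \<subseteq> e}. weight P e)"
    by (rule sum.swap_restrict) (auto simp: finite_H finite_pairs)
  finally show ?thesis by (simp add: load_def)
qed

text \<open>\<open>tight\<close> and \<open>exc\<close> are relations between vertices rather than
  sets of pairs, so that \<open>exc\<close> can serve as a conflict relation in
  \<open>select_sparse\<close>.\<close>

definition tight :: "nat \<Rightarrow> nat \<Rightarrow> bool" where
  "tight a b \<longleftrightarrow> a < n \<and> b < n \<and> a \<noteq> b \<and> load {a, b} = 6 * t"

definition exc :: "nat \<Rightarrow> nat \<Rightarrow> bool" where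
  "exc a b \<longleftrightarrow> a < n \<and> b < n \<and> a \<noteq> b \<and> load {a, b} \<noteq> 6 * t"

lemma exc_sym: "exc a b \<Longrightarrow> exc b a" by (auto simp: exc_def insert_commute)
lemma tight_sym: "tight a b \<Longrightarrow> tight b a" by (auto simp: tight_def insert_commute)
lemma tight_or_exc: "a < n \<Longrightarrow> b < n \<Longrightarrow> a \<noteq> b \<Longrightarrow> tight a b \<or> exc a b" by (auto simp: exc_def tight_def)

text \<open>A full load forces equality in \<open>cap_cd\<close>, so the codegree of a tight pair is
  in fact \<open>t\<close>, \<open>2 * t\<close> or \<open>3 * t\<close>.\<close>

lemma tight_codegree: "tight a b \<Longrightarrow> t \<le> cd {a, b}" "tight a b \<Longrightarrow> cd {a, b} \<le> 3 * t"
proof -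
  assume "tight a b"
  then have "6 * t \<le> cap {a, b} * cd {a, b}" using load_le_cap[of "{a, b}"] by (simp add: tight_def)
  then show "t \<le> cd {a, b}" "cd {a, b} \<le> 3 * t"
    using t2 by (auto simp: cap_def split: if_splits)
qed

lemma load_less:
  assumes "card P = 2" "e \<in> H" "P \<subseteq> e" "weight P e < cap P"
  shows "load P < 6 * t"
proof -
  have fin: "finite {e \<in> H. P \<subseteq> e}" using finite_H by simp
  have "load P < (\<Sum>e\<in>{e \<in> H. P \<subseteq> e}. cap P)"
    unfolding load_def
    by (rule sum_strict_mono_ex1[OF fin]) (use weight_le_cap through_pairs[OF assms(1)] assms in auto)
  also have "\<dots> \<le> 6 * t" using card_edges_through[OF assms(1)] cap_cd[of P] by (simp add: mult.commute)
  finally show ?thesis .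
qed

text \<open>A pair of codegree at most \<open>t\<close> can only be saturated by absorbing each of its edges completely, so that
  the other pairs of these edges are not saturated.\<close>
lemma two_tight:
  assumes e: "{a, b, c} \<in> H" and ab: "tight a b" and bc: "tight b c"
  shows "2 * t \<le> cd {a, b}"
proof (rule ccontr)
  assume small: "\<not> ?thesis"
  let ?e = "{a, b, c}"
  have d: "a \<noteq> b" "a \<noteq> c" "b \<noteq> c" using edge_distinct[OF e] by auto
  have sat: "load {a, b} = 6 * t" "load {b, c} = 6 * t" using ab bc by (auto simp: tight_def)
  have "6 * t \<le> cap {a, b} * cd {a, b}" using load_le_cap[of "{a, b}"] d sat by simp
  then have ct: "cd {a, b} \<le> t" using small by (auto simp: cap_def split: if_splits)
  have "\<not> weight {a, b} ?e < cap {a, b}" using load_less[of "{a, b}" ?e] d e sat by auto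
  then have w: "weight {a, b} ?e = 6" using ct weight_le_cap[OF e pair_in_pairs, of a b] d
    by (auto simp: cap_def)
  have abl: "{a, b} \<in> low 1 ?e" using ct d by (auto simp: low_def pairs_def)
  then have "6 div card (low 1 ?e) = 6" using w by (auto simp: weight_def split: if_splits)
  moreover have "card (low 1 ?e) = 1 \<or> card (low 1 ?e) = 2 \<or> card (low 1 ?e) = 3"
    using abl card_low[OF e, of 1] finite_low[OF e, of 1] card_gt_0_iff[of "low 1 ?e"] by fastforce
  ultimately have "card (low 1 ?e) = 1" by auto
  then have "low 1 ?e = {{a, b}}" using abl by (auto simp: card_1_singleton_iff)
  then have nb: "{b, c} \<notin> low 1 ?e" using d by (auto simp: doubleton_eq_iff)
  then have "weight {b, c} ?e = 0" using abl by (auto simp: weight_def)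
  moreover have "cap {b, c} \<noteq> 0"
    using tight_codegree(2)[OF bc] by (auto simp: cap_def)
  ultimately have "load {b, c} < 6 * t" using load_less[of "{b, c}" ?e] d e by auto
  then show False using sat by simp
qed

end

section \<open>Few good edges and few exceptional pairs\<close>

context fan_free
begin

text \<open>First \<open>t\<close> members of \<open>M\<close> are selected whose candidate vertices
  avoid the other members. Then \<open>greedy_sdr\<close> finds representatives for all their
  \<open>3 * t\<close> pairs at once, which completes a fan centred at \<open>p\<close>.\<close>

lemma no_good_matching:
  assumes M: "finite M" "pairwise disjnt M" "\<And>f. f \<in> M \<Longrightarrow> p \<notin> f \<and> insert p f \<in> good"
  shows "card M < t * (18 * t + 1)"
proof (rule ccontr)
  assume big: "\<not> ?thesis"
  have eH: "insert p f \<in> H" if "f \<in> M" for f using M(3)[OF that] by (simp add: good_def)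
  have goodD: "low 1 (insert p f) = {}" "card (low 2 (insert p f)) \<le> 1" "card (low 3 (insert p f)) \<le> 2"
    if "f \<in> M" for f using M(3)[OF that] by (simp_all add: good_def)
  have finf: "finite f" "card f = 2" if "f \<in> M" for f
    using finite_edge[OF eH[OF that]] edgeD(2)[OF eH[OF that]] M(3)[OF that] by auto
  have disj: "f \<inter> g = {}" if "f \<in> M" "g \<in> M" "f \<noteq> g" for f g
    using M(2) that by (auto simp: pairwise_def disjnt_def)
  \<comment> \<open>The \<open>- 1\<close> accounts for the third vertex of the edge, itself a
    neighbour of \<open>P\<close>. Truncation at \<open>3 * t\<close>, the number of representatives
    needed, bounds the conflicts.\<close>
  have "\<exists>X. X \<subseteq> nbrs H P - insert p f \<and> card X = min (cd P - 1) (3 * t)"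
    if f: "f \<in> M" and P: "P \<in> pairs (insert p f)" for f P
  proof -
    have PP: "P \<subseteq> insert p f" "card P = 2" using P by (auto simp: pairs_def)
    have "card (insert p f - P) = 1"
      using PP edgeD(2)[OF eH[OF f]] finite_edge[OF eH[OF f]] card_Diff_subset[of P "insert p f"] finite_subset
      by (metis Suc_1 diff_Suc_Suc diff_zero numeral_3_eq_3 One_nat_def)
    moreover have "nbrs H P - insert p f = nbrs H P - (insert p f - P)" by (auto simp: nbrs_def)
    ultimately have "cd P - 1 \<le> card (nbrs H P - insert p f)"
      using diff_card_le_card_Diff[of "insert p f - P" "nbrs H P"] finite_edge[OF eH[OF f]] by simp
    then have "min (cd P - 1) (3 * t) \<le> card (nbrs H P - insert p f)" by linarith
    then show ?thesis by (metis obtain_subset_with_card_n)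
  qed
  then obtain L where L: "\<And>f P. f \<in> M \<Longrightarrow> P \<in> pairs (insert p f) \<Longrightarrow>
      L f P \<subseteq> nbrs H P - insert p f \<and> card (L f P) = min (cd P - 1) (3 * t)" by metis
  have finL: "finite (L f P)" if "f \<in> M" "P \<in> pairs (insert p f)" for f P
    using L[OF that] finite_nbrs finite_subset by blast
  have finP: "finite (pairs (insert p f))" if "f \<in> M" for f
    using finite_pairs[OF finite_edge[OF eH[OF that]]] .
  define X where "X f = (\<Union>P\<in>pairs (insert p f). L f P)" for f
  have finX: "finite (X f)" if "f \<in> M" for f using finL finP that by (simp add: X_def)
  have cX: "card (X f) \<le> 9 * t" if "f \<in> M" for f
  proof -
    have "card (X f) \<le> (\<Sum>P\<in>pairs (insert p f). card (L f P))"
      unfolding X_def by (rule card_UN_le[OF finP[OF that]])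
    also have "\<dots> \<le> (\<Sum>P\<in>pairs (insert p f). 3 * t)" by (rule sum_mono) (use L[OF that] in simp)
    also have "\<dots> = 9 * t" using card_pairs_edge[OF eH[OF that]] by simp
    finally show ?thesis .
  qed
  have "\<exists>J\<subseteq>M. card J = t \<and> (\<forall>f\<in>J. \<forall>g\<in>J. f \<noteq> g \<longrightarrow> \<not> X f \<inter> g \<noteq> {})"
  proof (rule select_independent[OF M(1), where b = "9 * t"])
    fix f assume f: "f \<in> M"
    have "card {g \<in> M. X f \<inter> g \<noteq> {}} \<le> card (X f)"
      using card_hits_le[OF finX[OF f], of M "\<lambda>g. g"] disj by blast
    then show "card {g \<in> M. X f \<inter> g \<noteq> {}} \<le> 9 * t" using cX[OF f] by linarith
  next
    show "t * (2 * (9 * t) + 1) \<le> card M" using big by simp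
  qed
  then obtain J where J: "J \<subseteq> M" "card J = t"
    and indep: "\<And>f g. f \<in> J \<Longrightarrow> g \<in> J \<Longrightarrow> f \<noteq> g \<Longrightarrow> X f \<inter> g = {}" by blast
  have finJ: "finite J" using J(1) M(1) finite_subset by blast
  define S where "S = Sigma J (\<lambda>f. pairs (insert p f))"
  have finS: "finite S" using finJ finP J(1) by (auto simp: S_def)
  have SL: "fst j \<in> M" "snd j \<in> pairs (insert p (fst j))" if "j \<in> S" for j
    using that J(1) by (auto simp: S_def)
  have cS: "card {j \<in> S. snd j \<in> low k (insert p (fst j))} \<le> t * c"
    if c: "\<And>f. f \<in> M \<Longrightarrow> card (low k (insert p f)) \<le> c" for k c
  proof -
    have "{j \<in> S. snd j \<in> low k (insert p (fst j))} = Sigma J (\<lambda>f. low k (insert p f))"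
      using low_sub by (auto simp: S_def)
    moreover have "card (Sigma J (\<lambda>f. low k (insert p f))) = (\<Sum>f\<in>J. card (low k (insert p f)))"
      by (rule card_SigmaI) (use finJ finite_low[OF eH] J(1) in auto)
    moreover have "\<dots> \<le> card J * c" using sum_bounded_above[of J _ c] c J(1) by (metis of_nat_id subsetD)
    ultimately show ?thesis using J(2) by simp
  qed
  have cL: "card ((\<lambda>(f, P). L f P) j) = min (cd (snd j) - 1) (3 * t)" if "j \<in> S" for j
    using L[OF SL[OF that]] by (simp add: case_prod_beta)
  have "\<exists>g. inj_on g S \<and> (\<forall>j\<in>S. g j \<in> (\<lambda>(f, P). L f P) j)"
  proof (rule greedy_sdr[OF finS])
    show "finite ((\<lambda>(f, P). L f P) j)" if "j \<in> S" for j
      using finL[OF SL[OF that]] by (simp add: case_prod_beta)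
    fix j assume j: "j \<in> S"
    define m where "m = min (cd (snd j) - 1) (3 * t)"
    define B where "B = {i \<in> S. card ((\<lambda>(f, P). L f P) i) \<le> card ((\<lambda>(f, P). L f P) j)}"
    have B: "B = {i \<in> S. min (cd (snd i) - 1) (3 * t) \<le> m}"
      unfolding B_def m_def using cL j by auto
    have gt: "t < cd (snd j)" using goodD(1)[OF SL(1)[OF j]] SL(2)[OF j] by (auto simp: low_def)
    have sub: "card B \<le> card {i \<in> S. snd i \<in> low k (insert p (fst i))}" if "m < k * t" "k \<le> 3" for k
    proof (rule card_mono)
      have k3: "k * t \<le> 3 * t" using that(2) by simp
      have "cd (snd i) \<le> k * t" if "i \<in> B" for i
      proof -
        have "min (cd (snd i) - 1) (3 * t) \<le> m" using that by (simp add: B)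
        then show ?thesis using \<open>m < k * t\<close> k3 by linarith
      qed
      then show "B \<subseteq> {i \<in> S. snd i \<in> low k (insert p (fst i))}"
        using SL(2) by (auto simp: B low_def)
    qed (use finS in simp)
    \<comment> \<open>Lists shorter than \<open>2 * t\<close> come from pairs in
      \<open>low 2\<close>, at most one per edge, hence at most \<open>t\<close> in all, while
      \<open>m\<close> is at least \<open>t\<close>. Lists shorter than \<open>3 * t\<close> come
      from \<open>low 3\<close>, at most two per edge. Altogether there are \<open>3 * t\<close>
      lists.\<close>
    have "card B \<le> m"
    proof (cases "m < 3 * t")
      case False
      have "card B \<le> card S" by (rule card_mono[OF finS]) (auto simp: B)
      also have "card S = (\<Sum>f\<in>J. card (pairs (insert p f)))"
        unfolding S_def by (rule card_SigmaI) (use finJ finP J(1) in auto)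
      also have "\<dots> = (\<Sum>f\<in>J. 3)" by (rule sum.cong) (use card_pairs_edge[OF eH] J(1) in auto)
      also have "\<dots> = 3 * t" using J(2) by simp
      finally show ?thesis using False by simp
    next
      case True
      show ?thesis
      proof (cases "m < 2 * t")
        case False
        then show ?thesis using sub[of 3] True cS[of 3 2] goodD(3) by force
      next
        case True
        have "t \<le> m" using gt by (simp add: m_def)
        then show ?thesis using sub[of 2] True cS[of 2 1] goodD(2) by force
      qed
    qed
    then show "card {i \<in> S. card ((\<lambda>(f, P). L f P) i) \<le> card ((\<lambda>(f, P). L f P) j)}
      \<le> card ((\<lambda>(f, P). L f P) j)"
      unfolding B_def[symmetric] m_def using cL[OF j] by simp
  qed
  then obtain g where g: "inj_on g S" "\<forall>j\<in>S. g j \<in> (\<lambda>(f, P). L f P) j" by blast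
  have "\<exists>a b. a \<in> f \<and> b \<in> f \<and> a \<noteq> b \<and> f \<subseteq> {a, b}" if "f \<in> J" for f
    using finf(2)[of f] that J(1) by (auto simp: card_2_iff)
  then obtain q r where qr: "\<And>f. f \<in> J \<Longrightarrow> q f \<in> f \<and> r f \<in> f \<and> q f \<noteq> r f \<and> f \<subseteq> {q f, r f}" by metis
  have pqr: "p \<noteq> q f" "p \<noteq> r f" if "f \<in> J" for f using M(3)[of f] qr[OF that] that J(1) by auto
  have inS: "(f, {p, q f}) \<in> S" "(f, {p, r f}) \<in> S" "(f, {q f, r f}) \<in> S" if "f \<in> J" for f
    using qr[OF that] pqr[OF that] that by (auto simp: S_def intro!: pair_in_pairs)
  have gL: "g (f, P) \<in> nbrs H P" "g (f, P) \<notin> insert p f" "g (f, P) \<in> X f" if "(f, P) \<in> S" for f P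
  proof -
    have "g (f, P) \<in> L f P" using g(2) that by auto
    then show "g (f, P) \<in> nbrs H P" "g (f, P) \<notin> insert p f" "g (f, P) \<in> X f"
      using L[of f P] SL[OF that] by (auto simp: X_def)
  qed
  have ginj: "g (f, P) \<noteq> g (f', P')" if "(f, P) \<in> S" "(f', P') \<in> S" "(f, P) \<noteq> (f', P')" for f P f' P'
    using inj_onD[OF g(1) _ that(1,2)] that(3) by blast
  have "contains H (expansion 3 (fan t))"
  proof (rule contains_fanI[OF finJ J(2), where v = p and p = q and q = r and
        x = "\<lambda>f. g (f, {p, q f})" and y = "\<lambda>f. g (f, {p, r f})" and z = "\<lambda>f. g (f, {q f, r f})"])
    fix f assume f: "f \<in> J"
    note i = inS[OF f]
    have ne: "{p, q f} \<noteq> {p, r f}" "{p, q f} \<noteq> {q f, r f}" "{p, r f} \<noteq> {q f, r f}"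
      using qr[OF f] pqr[OF f] by (auto simp: doubleton_eq_iff)
    have "g (f, P) \<noteq> p" "g (f, P) \<noteq> q f" "g (f, P) \<noteq> r f" if "(f, P) \<in> S" for P
      using gL(2)[OF that] qr[OF f] by auto
    note o = this[OF i(1)] this[OF i(2)] this[OF i(3)]
    show "distinct [p, q f, r f, g (f, {p, q f}), g (f, {p, r f}), g (f, {q f, r f})]"
      using o ginj[OF i(1) i(2)] ginj[OF i(1) i(3)] ginj[OF i(2) i(3)] ne qr[OF f] pqr[OF f]
      by simp
    show "{p, q f, g (f, {p, q f})} \<in> H" "{p, r f, g (f, {p, r f})} \<in> H" "{q f, r f, g (f, {q f, r f})} \<in> H"
      using gL(1)[OF i(1)] gL(1)[OF i(2)] gL(1)[OF i(3)] by (simp_all add: in_nbrs)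
  next
    fix f h assume fh: "f \<in> J" "h \<in> J" "f \<noteq> h"
    let ?G = "\<lambda>f. {g (f, {p, q f}), g (f, {p, r f}), g (f, {q f, r f})}"
    have block: "{q f, r f, g (f, {p, q f}), g (f, {p, r f}), g (f, {q f, r f})} = f \<union> ?G f" if "f \<in> J" for f
      using qr[OF that] by auto
    have GX: "?G f \<subseteq> X f" if "f \<in> J" for f using gL(3) inS[OF that] by auto
    have "f \<inter> h = {}" using disj fh J(1) by blast
    moreover have "?G f \<inter> h = {}" "f \<inter> ?G h = {}"
      using indep[OF fh] indep[OF fh(2,1)] fh(3) GX[OF fh(1)] GX[OF fh(2)] by blast+
    moreover have "?G f \<inter> ?G h = {}"
      using ginj inS[OF fh(1)] inS[OF fh(2)] fh(3) by auto
    ultimately show "{q f, r f, g (f, {p, q f}), g (f, {p, r f}), g (f, {q f, r f})} \<inter>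
        {q h, r h, g (h, {p, q h}), g (h, {p, r h}), g (h, {q h, r h})} = {}"
      unfolding block[OF fh(1)] block[OF fh(2)] by blast
  qed
  then show False using free by simp
qed

text \<open>Every vertex of a good edge points to another vertex of that edge lying in its cover, so some ordering
  \<open>u, v, w\<close> of the edge has \<open>v\<close> in the cover of \<open>u\<close> and \<open>w\<close> in the cover of \<open>v\<close>.\<close>
lemma card_good: "card good \<le> n * (2 * (t * (18 * t + 1))) ^ 2"
proof -
  define m where "m = t * (18 * t + 1)"
  \<comment> \<open>\<open>C\<close> is the vertex set of a maximal matching in the link of
    \<open>p\<close> formed by the good edges.\<close>
  have "\<exists>C. finite C \<and> card C \<le> 2 * m \<and> (\<forall>e\<in>good. p \<in> e \<longrightarrow> (e - {p}) \<inter> C \<noteq> {})" for p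
  proof -
    define G where "G = (\<lambda>e. e - {p}) ` {e \<in> good. p \<in> e}"
    have finG: "finite G" using finite_H by (simp add: G_def good_def)
    obtain M where M: "M \<subseteq> G" "pairwise disjnt M" "\<forall>e\<in>G. e \<noteq> {} \<longrightarrow> e \<inter> \<Union>M \<noteq> {}"
      using maximal_matching[OF finG] by blast
    have finM: "finite M" using M(1) finG finite_subset by blast
    have in_M: "p \<notin> f \<and> insert p f \<in> good" if "f \<in> M" for f
      using that M(1) by (auto simp: G_def insert_absorb)
    have "card M < m" unfolding m_def by (rule no_good_matching[OF finM M(2) in_M])
    have cf: "finite f \<and> card f = 2" if "f \<in> M" for f
      using in_M[OF that] finite_edge[of "insert p f"] edgeD(2)[of "insert p f"] by (auto simp: good_def)
    have "card (\<Union>M) \<le> (\<Sum>f\<in>M. card f)" using card_Union_le_sum_card .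
    also have "\<dots> = 2 * card M" using cf by simp
    finally have "card (\<Union>M) \<le> 2 * m" using \<open>card M < m\<close> by simp
    moreover have "(e - {p}) \<inter> \<Union>M \<noteq> {}" if "e \<in> good" "p \<in> e" for e
    proof -
      have "card (e - {p}) = 2" using that edgeD(2)[of e] finite_edge[of e] by (simp add: good_def)
      then have "e - {p} \<noteq> {}" by (metis card.empty zero_neq_numeral)
      moreover have "e - {p} \<in> G" using that by (auto simp: G_def)
      ultimately show ?thesis using M(3)[THEN bspec] by simp
    qed
    moreover have "finite (\<Union>M)" using finM cf by simp
    ultimately show ?thesis by (intro exI[of _ "\<Union>M"]) simp
  qed
  then obtain C where C: "\<And>p. finite (C p)" "\<And>p. card (C p) \<le> 2 * m"
    "\<And>p e. e \<in> good \<Longrightarrow> p \<in> e \<Longrightarrow> (e - {p}) \<inter> C p \<noteq> {}" by metis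
  let ?T = "Sigma {..<n} (\<lambda>u. Sigma (C u) C)"
  have "good \<subseteq> (\<lambda>(u, v, w). {u, v, w}) ` ?T"
  proof
    fix e assume e: "e \<in> good"
    then have eH: "e \<in> H" by (simp add: good_def)
    obtain a b c where abc: "e = {a, b, c}" using edgeD(2)[OF eH] by (auto simp: card_3_iff)
    have pt: "\<exists>y\<in>e. y \<noteq> x \<and> y \<in> C x" if "x \<in> e" for x using C(3)[OF e that] by auto
    have "\<exists>u v w. e = {u, v, w} \<and> v \<in> C u \<and> w \<in> C v"
    proof -
      have "\<exists>y\<in>{a, b, c}. y \<noteq> a \<and> y \<in> C a" "\<exists>y\<in>{a, b, c}. y \<noteq> b \<and> y \<in> C b"
        "\<exists>y\<in>{a, b, c}. y \<noteq> c \<and> y \<in> C c" using pt abc by auto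
      then have "(b \<in> C a \<or> c \<in> C a) \<and> (a \<in> C b \<or> c \<in> C b) \<and> (a \<in> C c \<or> b \<in> C c)" by auto
      moreover have "e = {a, c, b}" "e = {b, a, c}" "e = {b, c, a}" "e = {c, a, b}" "e = {c, b, a}"
        using abc by auto
      ultimately show ?thesis using abc by metis
    qed
    then obtain u v w where "e = {u, v, w}" "v \<in> C u" "w \<in> C v" by blast
    moreover have "u < n" using edgeD(1)[OF eH] \<open>e = {u, v, w}\<close> by auto
    ultimately show "e \<in> (\<lambda>(u, v, w). {u, v, w}) ` ?T" by (intro image_eqI[where x = "(u, v, w)"]) auto
  qed
  moreover have finT: "finite ?T" using C(1) by auto
  ultimately have "card good \<le> card ?T"
    by (intro order_trans[OF card_mono card_image_le[OF finT]]) auto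
  also have "card ?T = (\<Sum>u<n. \<Sum>v\<in>C u. card (C v))"
    using C(1) by (simp add: card_SigmaI)
  also have "\<dots> \<le> (\<Sum>u<n. (2 * m) ^ 2)"
  proof (rule sum_mono)
    fix u
    have "(\<Sum>v\<in>C u. card (C v)) \<le> card (C u) * (2 * m)"
      using sum_bounded_above[of "C u" "\<lambda>v. card (C v)" "2 * m"] C(2) by simp
    also have "\<dots> \<le> (2 * m) * (2 * m)" using C(2) by simp
    finally show "(\<Sum>v\<in>C u. card (C v)) \<le> (2 * m) ^ 2" by (simp add: power2_eq_square)
  qed
  finally show ?thesis by (simp add: m_def)
qed

lemma finite_exc: "finite {(a, b). exc a b}"
  by (rule finite_subset[of _ "{..<n} \<times> {..<n}"]) (auto simp: exc_def)

text \<open>Every exceptional pair misses at least one sixth of an edge from the maximal load. Its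
  ordered versions lie in \<open>P \<times> P\<close>, which gives the factor 4, and
  \<open>24 = 4 * 6\<close>.\<close>

lemma card_exc: "card {(a, b). exc a b} + 24 * card (H - good) \<le> 24 * t * (n choose 2)"
proof -
  define EP where "EP = {P \<in> pairs {..<n}. load P \<noteq> 6 * t}"
  have finEP: "finite EP" by (simp add: EP_def finite_pairs)
  have "{(a, b). exc a b} \<subseteq> (\<Union>P\<in>EP. P \<times> P)"
  proof clarify
    fix a b assume "exc a b"
    then have "{a, b} \<in> EP" by (auto simp: exc_def EP_def pairs_def)
    then show "(a, b) \<in> (\<Union>P\<in>EP. P \<times> P)" by blast
  qed
  then have "card {(a, b). exc a b} \<le> card (\<Union>P\<in>EP. P \<times> P)"
    by (rule card_mono[rotated]) (use finEP in \<open>auto simp: EP_def pairs_def intro: finite_subset\<close>)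
  also have "\<dots> \<le> (\<Sum>P\<in>EP. card (P \<times> P))" by (rule card_UN_le[OF finEP])
  also have "\<dots> = (\<Sum>P\<in>EP. 4)" by (rule sum.cong) (auto simp: EP_def pairs_def card_cartesian_product)
  finally have 1: "card {(a, b). exc a b} \<le> 4 * card EP" by simp
  have "card EP + (\<Sum>P\<in>pairs {..<n}. load P) = (\<Sum>P\<in>pairs {..<n}. (if load P \<noteq> 6 * t then 1 else 0) + load P)"
    by (simp add: sum.distrib EP_def sum.If_cases finite_pairs Int_def)
  also have "\<dots> \<le> (\<Sum>P\<in>pairs {..<n}. 6 * t)"
  proof (rule sum_mono)
    fix P assume "P \<in> pairs {..<n}"
    then have "load P \<le> 6 * t" by (intro load_le) (simp add: pairs_def)
    then show "(if load P \<noteq> 6 * t then 1 else 0) + load P \<le> 6 * t" by auto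
  qed
  also have "\<dots> = 6 * t * (n choose 2)" by (simp add: card_pairs)
  finally show ?thesis using 1 sum_load by linarith
qed

end

section \<open>Comparison with the size of a star\<close>

lemma choose_two_shift: "k \<le> n \<Longrightarrow> n choose 2 \<le> ((n - k) choose 2) + k * n"
proof (induction k)
  case (Suc k)
  then obtain m where m: "n - k = Suc m" by (metis Suc_diff_Suc Suc_le_lessD)
  then have "(n - k) choose 2 = (m choose 2) + m" by (simp add: numeral_2_eq_2)
  moreover have "n - Suc k = m" "m \<le> n" using m by auto
  ultimately show ?case using Suc by simp
qed simp

text \<open>The star has at least \<open>t * (n choose 2) - t * t * n\<close> edges, written
  additively because subtraction truncates. By Pascal's rule the step to \<open>Suc t\<close> gains
  \<open>(n - Suc t) choose 2\<close>, which \<open>choose_two_shift\<close> compares with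
  \<open>n choose 2\<close>.\<close>

lemma star_size_lower: "t \<le> n \<Longrightarrow> t * (n choose 2) + ((n - t) choose 3) \<le> (n choose 3) + t * t * n"
proof (induction t)
  case (Suc t)
  then obtain m where m: "n - t = Suc m" by (metis Suc_diff_Suc Suc_le_lessD)
  then have "(n - t) choose 3 = (m choose 3) + (m choose 2)" by (simp add: numeral_3_eq_3 numeral_2_eq_2)
  moreover have m': "n - Suc t = m" using m by auto
  moreover have "n choose 2 \<le> (m choose 2) + Suc t * n" using choose_two_shift[OF Suc.prems] m' by simp
  moreover have "t * (n choose 2) + ((n - t) choose 3) \<le> (n choose 3) + t * t * n" using Suc by simp
  moreover have "t * t * n + Suc t * n \<le> Suc t * Suc t * n" by (simp add: algebra_simps)
  ultimately show ?case by simp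
qed simp

text \<open>\<open>t * t\<close> is the error in \<open>star_size_lower\<close>, the square is the
  factor in \<open>card_good\<close>, and 24 comes from \<open>card_exc\<close>.\<close>

definition exc_const :: "nat \<Rightarrow> nat" where
  "exc_const t = 24 * (t * t + (2 * (t * (18 * t + 1))) ^ 2)"

context fan_free
begin

text \<open>If \<open>H\<close> is at least as large as the star, only a linear deficit remains in
  \<open>card_exc\<close>.\<close>

lemma card_exc_le:
  assumes "t \<le> n" "(n choose 3) - ((n - t) choose 3) \<le> card H"
  shows "card {(a, b). exc a b} \<le> exc_const t * n"
proof -
  have "card H = card good + card (H - good)"
    using card_Un_disjoint[of good "H - good"] finite_H by (simp add: good_def Un_absorb1 subset_eq)
  then have "t * (n choose 2) \<le> card (H - good) + n * (2 * (t * (18 * t + 1))) ^ 2 + t * t * n"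
    using star_size_lower[OF assms(1)] assms(2) card_good by linarith
  then have "24 * t * (n choose 2) \<le> 24 * card (H - good) + exc_const t * n"
    unfolding exc_const_def by (simp add: algebra_simps)
  then show ?thesis using card_exc by linarith
qed

end

section \<open>The structure of tight pairs\<close>

lemma pair_up:
  assumes "finite J" "2 * m \<le> card J"
  obtains a c :: "nat \<Rightarrow> 'a" where "\<And>i. i < m \<Longrightarrow> a i \<in> J \<and> c i \<in> J \<and> a i \<noteq> c i"
    "\<And>i j. i < m \<Longrightarrow> j < m \<Longrightarrow> i \<noteq> j \<Longrightarrow> {a i, c i} \<inter> {a j, c j} = {}"
proof -
  obtain g where g: "bij_betw g {0..<card J} J" using ex_bij_betw_nat_finite[OF assms(1)] by blast
  have gJ: "g i \<in> J" if "i < 2 * m" for i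
    using bij_betwE[OF g] that assms(2) by auto
  have gi: "g i \<noteq> g j" if "i < 2 * m" "j < 2 * m" "i \<noteq> j" for i j
    using bij_betw_imp_inj_on[OF g] that assms(2) by (auto dest: inj_onD)
  show ?thesis
  proof
    show "g (2 * i) \<in> J \<and> g (2 * i + 1) \<in> J \<and> g (2 * i) \<noteq> g (2 * i + 1)" if "i < m" for i
      using that by (intro conjI gJ gi) auto
    show "{g (2 * i), g (2 * i + 1)} \<inter> {g (2 * j), g (2 * j + 1)} = {}" if "i < m" "j < m" "i \<noteq> j" for i j
      using gi[of "2 * i" "2 * j"] gi[of "2 * i" "2 * j + 1"] gi[of "2 * i + 1" "2 * j"]
        gi[of "2 * i + 1" "2 * j + 1"] that by simp
  qed
qed

text \<open>The size from which \<open>select_sparse\<close> extracts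
  \<open>2 * (t * (2 * t + 1))\<close> elements when conflicts average
  \<open>6 * t + (1 + 3 * t) * K * h\<close>.\<close>

definition spread_const :: "nat \<Rightarrow> nat \<Rightarrow> nat \<Rightarrow> nat" where
  "spread_const t K h = 4 * (t * (2 * t + 1)) * (4 * (6 * t + (1 + 3 * t) * K * h) + 1)"

context fan_free
begin

definition doubly_tight :: "nat \<Rightarrow> nat set" where
  "doubly_tight p = {q. tight p q \<and> (\<exists>x\<in>nbrs H {p, q}. tight p x)}"

lemma finite_doubly_tight: "finite (doubly_tight p)"
  by (rule finite_subset[of _ "{..<n}"]) (auto simp: doubly_tight_def tight_def)

text \<open>Here \<open>p\<close> is the centre: many \<open>q \<in> doubly_tight p\<close> have pairwise distinct private third vertices \<open>x q\<close>, so only the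
  outer edges of the triangles \<open>p, q, q'\<close> remain to be chosen, from lists of size at least \<open>t\<close>.\<close>
lemma card_doubly_tight:
  assumes E: "card {(a, b). exc a b} \<le> K * n" and n: "h * spread_const t K h \<le> n"
  shows "h * card (doubly_tight p) \<le> n"
proof (rule ccontr)
  assume "\<not> ?thesis"
  then have big: "n < h * card (doubly_tight p)" by simp
  define m where "m = t * (2 * t + 1)"
  define b where "b = 6 * t + (1 + 3 * t) * K * h"
  have sc: "spread_const t K h = 2 * (2 * m) * (4 * b + 1)" by (simp add: spread_const_def m_def b_def)
  have "h * spread_const t K h < h * card (doubly_tight p)" using big n by linarith
  then have cQ: "2 * (2 * m) * (4 * b + 1) \<le> card (doubly_tight p)" unfolding sc by simp
  have "\<exists>x. x \<in> nbrs H {p, q} \<and> tight p x" if "q \<in> doubly_tight p" for q using that by (auto simp: doubly_tight_def)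
  then obtain x where x: "\<And>q. q \<in> doubly_tight p \<Longrightarrow> x q \<in> nbrs H {p, q} \<and> tight p (x q)" by metis
  have pq: "tight p q" if "q \<in> doubly_tight p" for q using that by (simp add: doubly_tight_def)
  have xe: "{p, q, x q} \<in> H" if "q \<in> doubly_tight p" for q using x[OF that] by (simp add: in_nbrs)
  \<comment> \<open>Conflicts are a shared third vertex, an exceptional pair among
    \<open>{q, q'}\<close> and \<open>{x q, q'}\<close>, and \<open>p\<close> being a neighbour of
    \<open>{q, q'}\<close>.\<close>
  define R where "R q q' \<longleftrightarrow> x q = x q' \<or> exc q q' \<or> exc (x q) q' \<or> q' \<in> nbrs H {p, q}" for q q'
  define I where "I = doubly_tight p"
  have finI: "finite I" using finite_doubly_tight by (simp add: I_def)
  have cnt: "card {(q, q') \<in> I \<times> I. R q q'} \<le> b * card I"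
  proof -
    define S2 where "S2 = Sigma I (\<lambda>q. nbrs H {p, x q})"
    define S5 where "S5 = Sigma I (\<lambda>q. nbrs H {p, q})"
    define XP where "XP = {(a, b). exc a b}"
    define S4 where "S4 = (\<Union>e\<in>{e \<in> XP. tight p (fst e)}. nbrs H {p, fst e} \<times> {snd e})"
    have finXP: "finite XP" using finite_exc by (simp add: XP_def)
    have c2: "card S2 \<le> 3 * t * card I"
    proof -
      have "card S2 = (\<Sum>q\<in>I. cd {p, x q})" unfolding S2_def using finI finite_nbrs by (simp add: card_SigmaI)
      also have "\<dots> \<le> card I * (3 * t)"
        using sum_bounded_above[of I "\<lambda>q. cd {p, x q}" "3 * t"] tight_codegree(2) x by (simp add: I_def)
      finally show ?thesis by (simp add: mult.commute)
    qed
    have c5: "card S5 \<le> 3 * t * card I"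
    proof -
      have "card S5 = (\<Sum>q\<in>I. cd {p, q})" unfolding S5_def using finI finite_nbrs by (simp add: card_SigmaI)
      also have "\<dots> \<le> card I * (3 * t)"
        using sum_bounded_above[of I "\<lambda>q. cd {p, q}" "3 * t"] tight_codegree(2) pq by (simp add: I_def)
      finally show ?thesis by (simp add: mult.commute)
    qed
    have c4: "card S4 \<le> 3 * t * card XP"
    proof -
      have "card S4 \<le> (\<Sum>e\<in>{e \<in> XP. tight p (fst e)}. card (nbrs H {p, fst e} \<times> {snd e}))"
        unfolding S4_def by (rule card_UN_le) (use finXP in simp)
      also have "\<dots> \<le> (\<Sum>e\<in>{e \<in> XP. tight p (fst e)}. 3 * t)"
        by (rule sum_mono) (use tight_codegree(2) in \<open>auto simp: card_cartesian_product\<close>)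
      also have "\<dots> \<le> card XP * (3 * t)" using card_mono[OF finXP, of "{e \<in> XP. tight p (fst e)}"] by simp
      finally show ?thesis by (simp add: mult.commute)
    qed
    have fins: "finite S2" "finite S5" "finite S4"
      using finI finite_nbrs finXP by (auto simp: S2_def S5_def S4_def)
    have "{(q, q') \<in> I \<times> I. R q q'} \<subseteq> S2 \<union> XP \<union> S4 \<union> S5"
    proof (rule subsetI, rule ccontr)
      fix e assume "e \<in> {(q, q') \<in> I \<times> I. R q q'}" and e: "e \<notin> S2 \<union> XP \<union> S4 \<union> S5"
      then obtain q q' where "e = (q, q')" "q \<in> I" "q' \<in> I" "R q q'" by auto
      with e have q: "q \<in> I" "q' \<in> I" "R q q'" "(q, q') \<notin> S5" "(q, q') \<notin> S4" "(q, q') \<notin> S2"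
        "(q, q') \<notin> XP" by auto
      have qq: "q \<in> doubly_tight p" "q' \<in> doubly_tight p" using q by (auto simp: I_def)
      have n2: "x q \<noteq> x q'"
      proof
        assume "x q = x q'"
        then have "q' \<in> nbrs H {p, x q}" using edge_nbrs[OF xe[OF qq(2)]] by simp
        then show False using q by (simp add: S2_def)
      qed
      have n5: "q' \<notin> nbrs H {p, q}" using q by (simp add: S5_def)
      have n4: "\<not> exc (x q) q'"
      proof
        assume "exc (x q) q'"
        then have "(x q, q') \<in> {e \<in> XP. tight p (fst e)}" using x[OF qq(1)] by (simp add: XP_def)
        moreover have "q \<in> nbrs H {p, x q}" using edge_nbrs[OF xe[OF qq(1)]] by simp
        ultimately have "(q, q') \<in> S4" unfolding S4_def by (intro UN_I[of "(x q, q')"]) auto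
        then show False using q by simp
      qed
      show False using q(3,7) n2 n5 n4 by (simp add: R_def XP_def)
    qed
    then have "card {(q, q') \<in> I \<times> I. R q q'} \<le> card (S2 \<union> XP \<union> S4 \<union> S5)"
      by (rule card_mono[rotated]) (use fins finXP in simp)
    also have "\<dots> \<le> card S2 + card XP + card S4 + card S5"
      using card_Un_le[of "S2 \<union> XP \<union> S4" S5] card_Un_le[of "S2 \<union> XP" S4] card_Un_le[of S2 XP] by linarith
    also have "\<dots> \<le> 6 * t * card I + (1 + 3 * t) * card XP" using c2 c4 c5 by (simp add: algebra_simps)
    \<comment> \<open>The assumed size of \<open>doubly_tight p\<close>, more than
      \<open>n / h\<close>, turns the global bound \<open>K * n\<close> into a multiple of
      \<open>card I\<close>.\<close>
    also have "\<dots> \<le> 6 * t * card I + (1 + 3 * t) * (K * (h * card I))"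
    proof -
      have "card XP \<le> K * (h * card I)" using E big unfolding XP_def I_def
        by (meson le_trans less_imp_le mult_le_mono2)
      then show ?thesis by (meson add_left_mono mult_le_mono2)
    qed
    finally show ?thesis by (simp add: b_def algebra_simps)
  qed
  have "\<exists>J\<subseteq>I. card J = 2 * m \<and> (\<forall>i\<in>J. \<forall>j\<in>J. i \<noteq> j \<longrightarrow> \<not> R i j)"
    using select_sparse[OF finI cnt] cQ by (simp add: I_def)
  then obtain J where J: "J \<subseteq> I" "card J = 2 * m"
    and JR: "\<And>i j. i \<in> J \<Longrightarrow> j \<in> J \<Longrightarrow> i \<noteq> j \<Longrightarrow> \<not> R i j" by blast
  have finJ: "finite J" using J(1) finI finite_subset by blast
  obtain a c where ac: "\<And>i. i < m \<Longrightarrow> a i \<in> J \<and> c i \<in> J \<and> a i \<noteq> c i"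
    and ac_disj: "\<And>i j. i < m \<Longrightarrow> j < m \<Longrightarrow> i \<noteq> j \<Longrightarrow> {a i, c i} \<inter> {a j, c j} = {}"
    using pair_up[OF finJ, of m] J(2) by auto
  have JQ: "q \<in> doubly_tight p" if "q \<in> J" for q using that J(1) by (auto simp: I_def)
  have xd: "x q \<noteq> q'" if "q \<in> J" "q' \<in> J" for q q'
  proof (cases "q = q'")
    case True
    then show ?thesis using edge_distinct[OF xe[OF JQ[OF that(1)]]] by simp
  next
    case False
    then show ?thesis using JR[OF that False] x[OF JQ[OF that(1)]] by (auto simp: R_def)
  qed
  have xi: "x q \<noteq> x q'" if "q \<in> J" "q' \<in> J" "q \<noteq> q'" for q q' using JR[OF that] by (simp add: R_def)
  have pd: "p \<noteq> q" "p \<noteq> x q" if "q \<in> J" for q using edge_distinct[OF xe[OF JQ[OF that]]] by auto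
  have lt: "q < n" "x q < n" if "q \<in> J" for q using edge_less[OF xe[OF JQ[OF that]]] by auto
  have tJ: "tight q q'" if "q \<in> J" "q' \<in> J" "q \<noteq> q'" for q q'
    using tight_or_exc[OF lt(1)[OF that(1)] lt(1)[OF that(2)] that(3)] JR[OF that] by (auto simp: R_def)
  have txJ: "tight (x q) q'" if "q \<in> J" "q' \<in> J" "q \<noteq> q'" for q q'
    using tight_or_exc[OF lt(2)[OF that(1)] lt(1)[OF that(2)] xd[OF that(1,2)]] JR[OF that] by (auto simp: R_def)
  \<comment> \<open>If \<open>x q\<close> or \<open>x q'\<close> is a neighbour of
    \<open>{q, q'}\<close>, two tight pairs share an edge and \<open>two_tight\<close> raises the
    codegree to \<open>2 * t\<close>; deleting both vertices leaves \<open>2 * t - 2\<close>, which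
    is at least \<open>t\<close>.\<close>
  have listsize: "t \<le> card (nbrs H {q, q'} - {p, x q, x q'})" if "q \<in> J" "q' \<in> J" "q \<noteq> q'" for q q'
  proof -
    have "p \<notin> nbrs H {q, q'}"
    proof
      assume "p \<in> nbrs H {q, q'}"
      then have "q' \<in> nbrs H {p, q}" by (simp add: in_nbrs insert_commute)
      then show False using JR[OF that] by (simp add: R_def)
    qed
    then have eq: "nbrs H {q, q'} - {p, x q, x q'} = nbrs H {q, q'} - {x q, x q'}" by blast
    show ?thesis
    proof (cases "x q \<in> nbrs H {q, q'} \<or> x q' \<in> nbrs H {q, q'}")
      case False
      then have "nbrs H {q, q'} - {x q, x q'} = nbrs H {q, q'}" by blast
      then show ?thesis using eq tight_codegree(1)[OF tJ[OF that]] by simp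
    next
      case True
      then have "2 * t \<le> cd {q, q'}"
      proof
        assume "x q \<in> nbrs H {q, q'}"
        then have "{q, q', x q} \<in> H" by (simp add: in_nbrs)
        from two_tight[OF this tJ[OF that] tight_sym[OF txJ[OF that]]] show ?thesis .
      next
        assume "x q' \<in> nbrs H {q, q'}"
        then have "{q', q, x q'} \<in> H" by (simp add: in_nbrs insert_commute)
        from two_tight[OF this tJ[OF that(2,1)] tight_sym[OF txJ[OF that(2,1)]]] that(3)
        show ?thesis by (simp add: insert_commute)
      qed
      moreover have "cd {q, q'} - card {x q, x q'} \<le> card (nbrs H {q, q'} - {x q, x q'})"
        by (rule diff_card_le_card_Diff) simp
      moreover have "card {x q, x q'} \<le> 2" by (simp add: card_insert_if)
      ultimately show ?thesis using eq t2 by simp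
    qed
  qed
  \<comment> \<open>A list of exactly \<open>t\<close> vertices meets at most \<open>t\<close> of
    the disjoint bodies, so \<open>m = t * (2 * t + 1)\<close> pairs suffice to select
    \<open>t\<close> without conflict.\<close>
  have "\<exists>Z. Z \<subseteq> nbrs H {a i, c i} - {p, x (a i), x (c i)} \<and> card Z = t" if "i < m" for i
    using listsize[of "a i" "c i"] ac[OF that] by (metis obtain_subset_with_card_n)
  then obtain Z where Z: "\<And>i. i < m \<Longrightarrow> Z i \<subseteq> nbrs H {a i, c i} - {p, x (a i), x (c i)} \<and> card (Z i) = t"
    by metis
  let ?body = "\<lambda>i. {a i, c i, x (a i), x (c i)}"
  have body: "?body i \<inter> ?body j = {}" if "i < m" "j < m" "i \<noteq> j" for i j
  proof -
    have J4: "a i \<in> J" "c i \<in> J" "a j \<in> J" "c j \<in> J" using ac that by auto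
    have ne: "a i \<noteq> a j" "a i \<noteq> c j" "c i \<noteq> a j" "c i \<noteq> c j" using ac_disj[OF that] by auto
    show ?thesis using ne xd J4 xi[OF J4(1,3) ne(1)] xi[OF J4(1,4) ne(2)] xi[OF J4(2,3) ne(3)]
        xi[OF J4(2,4) ne(4)] by (simp add: xd[symmetric])
  qed
  have finZ: "finite (Z i)" if "i < m" for i using Z[OF that] finite_nbrs finite_subset by blast
  have "\<exists>S\<subseteq>{..<m}. card S = t \<and> (\<forall>i\<in>S. \<forall>j\<in>S. i \<noteq> j \<longrightarrow> \<not> Z i \<inter> ?body j \<noteq> {})"
  proof (rule select_independent[where b = t])
    fix i assume "i \<in> {..<m}"
    then have i: "i < m" by simp
    have "card {j \<in> {..<m}. Z i \<inter> ?body j \<noteq> {}} \<le> card (Z i)"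
      by (rule card_hits_le[OF finZ[OF i]]) (use body in blast)
    then show "card {j \<in> {..<m}. Z i \<inter> ?body j \<noteq> {}} \<le> t" using Z[OF i] by simp
  qed (simp_all add: m_def)
  then obtain S where S: "S \<subseteq> {..<m}" "card S = t"
    and ZS: "\<And>i j. i \<in> S \<Longrightarrow> j \<in> S \<Longrightarrow> i \<noteq> j \<Longrightarrow> Z i \<inter> ?body j = {}" by blast
  have Sm: "i < m" if "i \<in> S" for i using S(1) that by blast
  show False
  proof (rule no_fan_fixed_spokes[where I = S and v = p and p = a and q = c and x = "\<lambda>i. x (a i)"
        and y = "\<lambda>i. x (c i)" and Z = Z])
    show "finite S" using S(1) finite_subset by blast
    show "card S = t" by (rule S(2))
  next
    fix i assume i: "i \<in> S"
    have J2: "a i \<in> J" "c i \<in> J" "a i \<noteq> c i" using ac[OF Sm[OF i]] by auto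
    show "distinct [p, a i, c i, x (a i), x (c i)]"
      using pd[OF J2(1)] pd[OF J2(2)] xd J2 xi[OF J2] by (simp add: xd[symmetric])
    show "{p, a i, x (a i)} \<in> H" "{p, c i, x (c i)} \<in> H" using xe JQ J2 by auto
    show "Z i \<subseteq> nbrs H {a i, c i} - {p, x (a i), x (c i)}" "t \<le> card (Z i)" using Z[OF Sm[OF i]] by auto
  next
    fix i j assume ij: "i \<in> S" "j \<in> S" "i \<noteq> j"
    show "?body i \<inter> ?body j = {}" by (rule body[OF Sm[OF ij(1)] Sm[OF ij(2)] ij(3)])
    show "Z i \<inter> ?body j = {}" by (rule ZS[OF ij])
  qed
qed

end

section \<open>A linear-size core whose pairs have a common neighbourhood\<close>

definition core_sparse :: "nat \<Rightarrow> nat" where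
  "core_sparse K = 2 * (4 * (8 * 2 ^ (2 * K) * K) + 1)"

text \<open>The factor \<open>8 * 2 ^ (2 * K)\<close> is lost on the way to the set
  \<open>A'\<close> of \<open>core_exists\<close>, and \<open>2 * core_sparse K\<close> when
  thinning \<open>A'\<close> to pairwise tight vertices.\<close>

definition core_const :: "nat \<Rightarrow> nat" where
  "core_const K = 8 * 2 ^ (2 * K) * (2 * core_sparse K)"

text \<open>The summands serve \<open>core_exists\<close> in turn: bounding doubly tight partners,
  bounding bad pairs, removing the covers, and the final sparse selection.\<close>

definition core_bound :: "nat \<Rightarrow> nat \<Rightarrow> nat" where
  "core_bound t K = 16 * spread_const t K 16 + 16 * (1 + 2 * K + 2 * K * (5 * t + 1))
     + 4 * 2 ^ (2 * K) * (2 * (2 * K * (2 * (t * (2 * t + 1))))) + 8 * 2 ^ (2 * K) * (2 * core_sparse K)"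

context fan_free
begin

text \<open>Otherwise \<open>t\<close> members of \<open>M\<close> whose lists avoid the other
  chosen members span a fan centred at \<open>s\<close>.\<close>

lemma rich_matching:
  assumes M: "finite M" "pairwise disjnt M"
    and f: "\<And>f. f \<in> M \<Longrightarrow> card f = 2 \<and> s \<notin> f \<and> t \<le> card (nbrs H f - {s})"
      "\<And>f q. f \<in> M \<Longrightarrow> q \<in> f \<Longrightarrow> 5 * t + 1 \<le> cd {s, q}"
  shows "card M < t * (2 * t + 1)"
proof (rule ccontr)
  assume big: "\<not> ?thesis"
  have disj: "f \<inter> g = {}" if "f \<in> M" "g \<in> M" "f \<noteq> g" for f g
    using M(2) that by (auto simp: pairwise_def disjnt_def)
  have "\<exists>Z. Z \<subseteq> nbrs H g - {s} \<and> card Z = t" if "g \<in> M" for g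
    using f(1)[OF that] by (metis obtain_subset_with_card_n)
  then obtain Z where Z: "\<And>g. g \<in> M \<Longrightarrow> Z g \<subseteq> nbrs H g - {s} \<and> card (Z g) = t" by metis
  have finZ: "finite (Z g)" if "g \<in> M" for g using Z[OF that] finite_nbrs finite_subset by blast
  have "\<exists>J\<subseteq>M. card J = t \<and> (\<forall>f\<in>J. \<forall>g\<in>J. f \<noteq> g \<longrightarrow> \<not> Z f \<inter> g \<noteq> {})"
  proof (rule select_independent[OF M(1), where b = t])
    fix g assume g: "g \<in> M"
    have "card {h \<in> M. Z g \<inter> h \<noteq> {}} \<le> card (Z g)"
      using card_hits_le[OF finZ[OF g], of M "\<lambda>g. g"] disj by blast
    then show "card {h \<in> M. Z g \<inter> h \<noteq> {}} \<le> t" using Z[OF g] by simp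
  qed (use big in simp)
  then obtain J where J: "J \<subseteq> M" "card J = t"
    and indep: "\<And>f g. f \<in> J \<Longrightarrow> g \<in> J \<Longrightarrow> f \<noteq> g \<Longrightarrow> Z f \<inter> g = {}" by blast
  have JM: "g \<in> M" if "g \<in> J" for g using J(1) that by blast
  have "\<exists>a b. g = {a, b} \<and> a \<noteq> b" if "g \<in> J" for g
    using f(1)[OF JM[OF that]] by (auto simp: card_2_iff)
  then obtain q r where qr: "\<And>g. g \<in> J \<Longrightarrow> {q g, r g} = g \<and> q g \<noteq> r g" by metis
  show False
  proof (rule no_fan_rich_centre_lists[where I = J and v = s and p = q and q = r and Z = Z])
    show "finite J" using J(1) M(1) finite_subset by blast
    show "card J = t" by (rule J(2))
  next
    fix g assume g: "g \<in> J"
    have qg: "q g \<in> g" "r g \<in> g" using qr[OF g] by blast+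
    show "distinct [s, q g, r g]" using qr[OF g] f(1)[OF JM[OF g]] qg by auto
    show "Z g \<subseteq> nbrs H {q g, r g} - {s}" "t \<le> card (Z g)"
      using Z[OF JM[OF g]] qr[OF g] by simp_all
    show "5 * t + 1 \<le> cd {s, q g}" "5 * t + 1 \<le> cd {s, r g}" using f(2)[OF JM[OF g]] qg by blast+
  next
    fix g h assume gh: "g \<in> J" "h \<in> J" "g \<noteq> h"
    have e: "{q g, r g} = g" "{q h, r h} = h" using qr gh by blast+
    show "{q g, r g} \<inter> {q h, r h} = {}" unfolding e by (rule disj[OF JM[OF gh(1)] JM[OF gh(2)] gh(3)])
    show "Z g \<inter> {q h, r h} = {}" unfolding e by (rule indep[OF gh])
  qed
qed

text \<open>A typical vertex \<open>p0\<close> is chosen whose pairs with a quarter of all vertices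
  have neighbourhoods in a bounded set. Pigeonholing gives many \<open>q\<close> with the same
  neighbourhood \<open>R\<close>. Removing bounded covers destroys all pairs with \<open>t\<close>
  neighbours besides some element of \<open>R\<close>; a tight pair among the remaining vertices
  must have neighbourhood exactly \<open>R\<close>.\<close>

lemma core_exists:
  assumes E: "card {(a, b). exc a b} \<le> K * n" and n: "core_bound t K \<le> n"
  shows "\<exists>T A. card T = t \<and> A \<subseteq> {..<n} \<and> n \<le> core_const K * card A \<and>
    (\<forall>q\<in>A. \<forall>q'\<in>A. q \<noteq> q' \<longrightarrow> nbrs H {q, q'} = T)"
proof -
  define D where "D = 2 * K"
  define C0 where "C0 = 5 * t + 1"
  define m where "m = t * (2 * t + 1)"
  have n1: "16 * spread_const t K 16 \<le> n" "16 * (1 + D + D * C0) \<le> n"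
    "4 * 2 ^ D * (2 * (D * (2 * m))) \<le> n" "8 * 2 ^ D * (2 * core_sparse K) \<le> n"
    using n by (simp_all add: core_bound_def D_def C0_def m_def)
  define Eo where "Eo p = {q. exc p q}" for p
  have Eo_sub: "Eo p \<subseteq> {..<n}" for p by (auto simp: Eo_def exc_def)
  have finEo: "finite (Eo p)" for p using Eo_sub finite_subset by blast
  define P0 where "P0 = {p \<in> {..<n}. card (Eo p) \<le> D}"
  have finP0: "finite P0" by (simp add: P0_def)
  \<comment> \<open>Markov's inequality: on average a vertex has at most \<open>K\<close>
    exceptional partners, so at most half of the vertices have more than
    \<open>2 * K\<close>.\<close>
  have P0: "n \<le> 2 * card P0"
  proof -
    have "{(a, b). exc a b} = Sigma {..<n} Eo" by (auto simp: Eo_def exc_def)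
    then have sum: "(\<Sum>p<n. card (Eo p)) \<le> K * n" using E finEo by simp
    let ?B = "{..<n} - P0"
    have "2 * K + 1 \<le> card (Eo p)" if "p \<in> ?B" for p using that by (auto simp: P0_def D_def)
    then have "card ?B * (2 * K + 1) \<le> (\<Sum>p\<in>?B. card (Eo p))"
      using sum_bounded_below[of ?B "2 * K + 1" "\<lambda>p. card (Eo p)"] by simp
    also have "\<dots> \<le> (\<Sum>p<n. card (Eo p))" by (rule sum_mono2) auto
    finally have "2 * card ?B * (2 * K + 1) \<le> n * (2 * K + 1)" using sum by (simp add: algebra_simps)
    then have "2 * card ?B \<le> n" by (metis Suc_eq_plus1 mult_le_cancel2 zero_less_Suc)
    moreover have "card ?B = n - card P0" using card_Diff_subset[OF finP0, of "{..<n}"] by (auto simp: P0_def)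
    moreover have "card P0 \<le> n" using card_mono[of "{..<n}" P0] by (auto simp: P0_def)
    ultimately show ?thesis by linarith
  qed
  have npos: "0 < n" using n1(2) by simp
  then have P0_ne: "P0 \<noteq> {}" using P0 by (intro notI) simp
  \<comment> \<open>The relation is directed. For \<open>p0\<close>, the direction
    \<open>bad p0 q\<close> confines neighbourhoods to \<open>Eo p0\<close>, while
    \<open>bad q p0\<close> makes the codegrees \<open>cd {q, s}\<close> large.\<close>
  define bad where "bad p q \<longleftrightarrow> \<not> tight p q \<or> q \<in> doubly_tight p \<or> (\<exists>s\<in>nbrs H {p, q}. cd {p, s} < C0)" for p q
  have out: "card {q \<in> P0. bad p q} \<le> n div 8" if p: "p \<in> P0" for p
  proof -
    \<comment> \<open>\<open>X\<close> catches the \<open>q\<close> that are bad through the last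
      clause alone. The culprit \<open>s\<close> is then one of at most \<open>D\<close> exceptional
      partners of \<open>p\<close>, and \<open>{p, s}\<close> has fewer than \<open>C0\<close>
      neighbours.\<close>
    define X where "X = (\<Union>s\<in>{s \<in> Eo p. cd {p, s} < C0}. nbrs H {p, s})"
    have cE: "card (Eo p) \<le> D" "p < n" using p by (auto simp: P0_def)
    have finX: "finite X" using finEo finite_nbrs by (simp add: X_def)
    have "card X \<le> (\<Sum>s\<in>{s \<in> Eo p. cd {p, s} < C0}. cd {p, s})"
      unfolding X_def by (rule card_UN_le) (simp add: finEo)
    also have "\<dots> \<le> (\<Sum>s\<in>{s \<in> Eo p. cd {p, s} < C0}. C0)" by (rule sum_mono) auto
    also have "\<dots> \<le> card (Eo p) * C0" using card_mono[OF finEo[of p], of "{s \<in> Eo p. cd {p, s} < C0}"] by simp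
    also have "\<dots> \<le> D * C0" using cE by simp
    finally have cX: "card X \<le> D * C0" .
    have "{q \<in> P0. bad p q} \<subseteq> {p} \<union> Eo p \<union> doubly_tight p \<union> X"
    proof (rule subsetI, rule ccontr)
      fix q assume q: "q \<in> {q \<in> P0. bad p q}" and nq: "q \<notin> {p} \<union> Eo p \<union> doubly_tight p \<union> X"
      have "q < n" using q by (auto simp: P0_def)
      then have tq: "tight p q" using tight_or_exc[of p q] cE nq by (auto simp: Eo_def)
      then obtain s where s: "s \<in> nbrs H {p, q}" "cd {p, s} < C0" using q nq by (auto simp: bad_def)
      then have e: "{p, q, s} \<in> H" by (simp add: in_nbrs)
      have "\<not> tight p s" using nq tq s(1) by (auto simp: doubly_tight_def)
      then have "exc p s" using tight_or_exc[of p s] edge_distinct[OF e] edge_less[OF e] by auto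
      moreover have "q \<in> nbrs H {p, s}" using edge_nbrs[OF e] by simp
      ultimately have "q \<in> X" using s(2) by (auto simp: X_def Eo_def)
      then show False using nq by simp
    qed
    then have "card {q \<in> P0. bad p q} \<le> card ({p} \<union> Eo p \<union> doubly_tight p \<union> X)"
      by (rule card_mono[rotated]) (simp add: finEo finite_doubly_tight finX)
    also have "\<dots> \<le> card {p} + card (Eo p) + card (doubly_tight p) + card X"
      using card_Un_le[of "{p} \<union> Eo p \<union> doubly_tight p" X] card_Un_le[of "{p} \<union> Eo p" "doubly_tight p"] card_Un_le[of "{p}" "Eo p"]
      by linarith
    also have "\<dots> \<le> 1 + D + card (doubly_tight p) + D * C0" using cX cE by simp
    finally have "card {q \<in> P0. bad p q} \<le> 1 + D + card (doubly_tight p) + D * C0" .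
    moreover have "16 * card (doubly_tight p) \<le> n" by (rule card_doubly_tight[OF E n1(1)])
    moreover have "16 + 16 * D + 16 * (D * C0) \<le> n" using n1(2) by simp
    ultimately have "card {q \<in> P0. bad p q} * 8 \<le> n" by linarith
    then show ?thesis by (simp add: less_eq_div_iff_mult_less_eq)
  qed
  have "\<exists>p\<in>P0. card {q \<in> P0. bad q p} \<le> n div 8"
    by (rule ex_small_indegree[OF finP0 P0_ne out])
  then obtain p0 where p0: "p0 \<in> P0" "card {q \<in> P0. bad q p0} \<le> n div 8" ..
  define G0 where "G0 = {q \<in> P0. \<not> bad p0 q \<and> \<not> bad q p0}"
  have "n \<le> 4 * card G0"
  proof -
    have "card P0 \<le> card (G0 \<union> {q \<in> P0. bad p0 q} \<union> {q \<in> P0. bad q p0})"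
      by (rule card_mono) (auto simp: G0_def finP0)
    then have "card P0 \<le> card G0 + card {q \<in> P0. bad p0 q} + card {q \<in> P0. bad q p0}"
      using card_Un_le[of "G0 \<union> {q \<in> P0. bad p0 q}" "{q \<in> P0. bad q p0}"]
        card_Un_le[of G0 "{q \<in> P0. bad p0 q}"] by linarith
    then have "card P0 \<le> card G0 + 2 * (n div 8)" using out[OF p0(1)] p0(2) by linarith
    then show ?thesis using P0 by linarith
  qed
  have G0D: "tight p0 q" "nbrs H {p0, q} \<subseteq> Eo p0" "\<And>s. s \<in> nbrs H {p0, q} \<Longrightarrow> C0 \<le> cd {q, s}" if "q \<in> G0" for q
  proof -
    have nb: "\<not> bad p0 q" "\<not> bad q p0" using that by (auto simp: G0_def)
    show tq: "tight p0 q" using nb by (simp add: bad_def)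
    show "nbrs H {p0, q} \<subseteq> Eo p0"
    proof
      fix s assume s: "s \<in> nbrs H {p0, q}"
      then have e: "{p0, q, s} \<in> H" by (simp add: in_nbrs)
      have "\<not> tight p0 s" using nb s tq by (auto simp: bad_def doubly_tight_def)
      then show "s \<in> Eo p0"
        using tight_or_exc[of p0 s] edge_distinct[OF e] edge_less[OF e] by (auto simp: Eo_def)
    qed
    show "C0 \<le> cd {q, s}" if "s \<in> nbrs H {p0, q}" for s
    proof -
      have "s \<in> nbrs H {q, p0}" using that by (simp add: insert_commute)
      then show ?thesis using nb(2) by (auto simp: bad_def not_less)
    qed
  qed
  have finG0: "finite G0" using finP0 by (simp add: G0_def)
  have G0_ne: "G0 \<noteq> {}" using \<open>n \<le> 4 * card G0\<close> npos by (intro notI) simp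
  \<comment> \<open>At most \<open>2 ^ D\<close> neighbourhoods can occur, since
    \<open>Eo p0\<close> has at most \<open>D\<close> elements.\<close>
  have "\<exists>R\<in>Pow (Eo p0). card G0 \<le> card (Pow (Eo p0)) * card {q \<in> G0. nbrs H {p0, q} = R}"
    by (rule pigeonhole_fibre[OF finG0 G0_ne]) (use finEo G0D(2) in auto)
  then obtain R where R: "R \<subseteq> Eo p0" "card G0 \<le> card (Pow (Eo p0)) * card {q \<in> G0. nbrs H {p0, q} = R}"
    by blast
  define VR where "VR = {q \<in> G0. nbrs H {p0, q} = R}"
  have finVR: "finite VR" using finG0 by (simp add: VR_def)
  have VRlt: "q < n" if "q \<in> VR" for q using that by (auto simp: VR_def G0_def P0_def)
  have cEo: "card (Eo p0) \<le> D" using p0(1) by (simp add: P0_def)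
  have "card (Pow (Eo p0)) \<le> 2 ^ D" using cEo by (simp add: card_Pow finEo)
  then have "card G0 \<le> 2 ^ D * card VR" using R(2) unfolding VR_def[symmetric]
    by (meson le_trans mult_le_mono1)
  then have nVR: "n \<le> 4 * 2 ^ D * card VR" using \<open>n \<le> 4 * card G0\<close> by simp
  have "VR \<noteq> {}" using nVR npos by (intro notI) simp
  then obtain q0 where q0: "q0 \<in> VR" by blast
  have tR: "t \<le> card R" using tight_codegree(1)[OF G0D(1), of q0] q0 by (auto simp: VR_def)
  have finR: "finite R" using R(1) finEo finite_subset by blast
  have cR: "card R \<le> D" using card_mono[OF finEo R(1)] cEo by linarith
  have rich: "C0 \<le> cd {s, q}" "q \<noteq> s" if "s \<in> R" "q \<in> VR" for s q
    using G0D(3)[of q s] that by (auto simp: VR_def nbrs_def insert_commute)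
  \<comment> \<open>By \<open>rich_matching\<close> the graph \<open>G s\<close> has only bounded
    matchings, hence a bounded cover \<open>W s\<close>.\<close>
  define G where "G s = {f \<in> pairs VR. t \<le> card (nbrs H f - {s})}" for s
  have "\<exists>W. finite W \<and> card W \<le> 2 * m \<and> (\<forall>f\<in>G s. f \<inter> W \<noteq> {})" if s: "s \<in> R" for s
  proof -
    have finG: "finite (G s)" using finite_pairs[OF finVR] by (simp add: G_def)
    obtain M where M: "M \<subseteq> G s" "pairwise disjnt M" "\<forall>e\<in>G s. e \<noteq> {} \<longrightarrow> e \<inter> \<Union>M \<noteq> {}"
      using maximal_matching[OF finG] by blast
    have finM: "finite M" using M(1) finG finite_subset by blast
    have in_M: "f \<subseteq> VR" "card f = 2" "t \<le> card (nbrs H f - {s})" if "f \<in> M" for f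
      using that M(1) by (auto simp: G_def pairs_def)
    have "card M < m" unfolding m_def
    proof (rule rich_matching[OF finM M(2), of s])
      fix f assume f: "f \<in> M"
      show "card f = 2 \<and> s \<notin> f \<and> t \<le> card (nbrs H f - {s})"
        using in_M[OF f] rich(2)[OF s] by auto
      show "5 * t + 1 \<le> cd {s, q}" if "q \<in> f" for q
        using rich(1)[OF s, of q] in_M(1)[OF f] that by (auto simp: C0_def)
    qed
    have "card (\<Union>M) \<le> (\<Sum>f\<in>M. card f)" using card_Union_le_sum_card .
    also have "\<dots> = 2 * card M" using in_M by simp
    finally have "card (\<Union>M) \<le> 2 * m" using \<open>card M < m\<close> by simp
    moreover have "finite (\<Union>M)"
      using finM in_M(1) finVR finite_subset by (metis finite_Union)
    moreover have "f \<inter> \<Union>M \<noteq> {}" if "f \<in> G s" for f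
    proof -
      have "f \<noteq> {}" using that by (auto simp: G_def pairs_def)
      then show ?thesis using M(3)[THEN bspec, OF that] by simp
    qed
    ultimately show ?thesis by (intro exI[of _ "\<Union>M"]) simp
  qed
  then obtain W where W: "\<And>s. s \<in> R \<Longrightarrow> finite (W s)" "\<And>s. s \<in> R \<Longrightarrow> card (W s) \<le> 2 * m"
    "\<And>s f. s \<in> R \<Longrightarrow> f \<in> G s \<Longrightarrow> f \<inter> W s \<noteq> {}" by metis
  define A' where "A' = VR - (\<Union>s\<in>R. W s)"
  have finA': "finite A'" using finVR by (simp add: A'_def)
  have nA': "n \<le> 8 * 2 ^ D * card A'"
  proof -
    have "card (\<Union>s\<in>R. W s) \<le> (\<Sum>s\<in>R. card (W s))" by (rule card_UN_le[OF finR])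
    also have "\<dots> \<le> card R * (2 * m)" using sum_bounded_above[of R "\<lambda>s. card (W s)" "2 * m"] W(2) by simp
    also have "\<dots> \<le> D * (2 * m)" using cR by simp
    finally have cW: "card (\<Union>s\<in>R. W s) \<le> D * (2 * m)" .
    have "(4 * 2 ^ D) * (2 * (D * (2 * m))) \<le> (4 * 2 ^ D) * card VR" using n1(3) nVR by linarith
    then have "2 * (D * (2 * m)) \<le> card VR" by simp
    moreover have "card VR - card (\<Union>s\<in>R. W s) \<le> card A'"
      unfolding A'_def by (rule diff_card_le_card_Diff) (use finR W(1) in simp)
    ultimately have "card VR \<le> 2 * card A'" using cW by linarith
    then have "4 * 2 ^ D * card VR \<le> 4 * 2 ^ D * (2 * card A')" by (rule mult_le_mono2)
    also have "\<dots> = 8 * 2 ^ D * card A'" by simp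
    finally show ?thesis using nVR by linarith
  qed
  define b where "b = 8 * 2 ^ D * K"
  define c where "c = core_sparse K"
  have c_eq: "c = 2 * (4 * b + 1)" by (simp add: c_def core_sparse_def b_def D_def)
  define k where "k = card A' div c"
  have cnt: "card {(q, q') \<in> A' \<times> A'. exc q q'} \<le> b * card A'"
  proof -
    have "card {(q, q') \<in> A' \<times> A'. exc q q'} \<le> card {(a, b). exc a b}"
      by (rule card_mono[OF finite_exc]) auto
    also have "\<dots> \<le> K * n" by (rule E)
    also have "\<dots> \<le> K * (8 * 2 ^ D * card A')" using nA' by simp
    finally show ?thesis by (simp add: b_def algebra_simps)
  qed
  have "2 * k * (4 * b + 1) \<le> card A'"
  proof -
    have "2 * k * (4 * b + 1) = k * c" by (simp add: c_eq algebra_simps)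
    then show ?thesis unfolding k_def by simp
  qed
  then have "\<exists>A\<subseteq>A'. card A = k \<and> (\<forall>i\<in>A. \<forall>j\<in>A. i \<noteq> j \<longrightarrow> \<not> exc i j)"
    by (rule select_sparse[OF finA' cnt])
  then obtain A where A: "A \<subseteq> A'" "card A = k" "\<And>i j. i \<in> A \<Longrightarrow> j \<in> A \<Longrightarrow> i \<noteq> j \<Longrightarrow> \<not> exc i j" by blast
  have cpos: "0 < c" by (simp add: c_eq)
  have "(8 * 2 ^ D) * (2 * c) \<le> (8 * 2 ^ D) * card A'" using n1(4) nA' unfolding c_def by linarith
  then have "2 * c \<le> card A'" by simp
  then have k2: "2 \<le> k" unfolding k_def using cpos by (simp add: less_eq_div_iff_mult_less_eq)
  have "card A' \<le> 2 * c * k"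
  proof -
    have "card A' \<le> c * k + c" unfolding k_def using cpos
      by (metis add_le_cancel_left div_mult_mod_eq mod_less_divisor mult.commute nat_less_le)
    also have "\<dots> \<le> c * k + c * k" using k2 by simp
    finally show ?thesis by simp
  qed
  then have "8 * 2 ^ D * card A' \<le> 8 * 2 ^ D * (2 * c * k)" by (rule mult_le_mono2)
  also have "\<dots> = core_const K * card A"
    using A(2) by (simp add: core_const_def c_def D_def)
  finally have nA: "n \<le> core_const K * card A" using nA' by linarith
  have AV: "q \<in> VR" "\<And>s. s \<in> R \<Longrightarrow> q \<notin> W s" if "q \<in> A" for q using that A(1) by (auto simp: A'_def)
  have main: "nbrs H {q, q'} = R" "card R = t" if q: "q \<in> A" "q' \<in> A" "q \<noteq> q'" for q q'
  proof -
    have tq: "tight q q'"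
      using tight_or_exc[of q q'] VRlt AV(1) q A(3)[OF q] by blast
    have c1: "t \<le> cd {q, q'}" by (rule tight_codegree(1)[OF tq])
    \<comment> \<open>There are fewer than \<open>t\<close> neighbours besides \<open>s\<close> but
      at least \<open>t\<close> in all, so \<open>s\<close> is one of exactly \<open>t\<close>
      neighbours.\<close>
    have each: "s \<in> nbrs H {q, q'} \<and> cd {q, q'} \<le> t" if s: "s \<in> R" for s
    proof -
      have "{q, q'} \<inter> W s = {}" using AV(2)[OF q(1) s] AV(2)[OF q(2) s] by simp
      then have "{q, q'} \<notin> G s" using W(3)[OF s] by blast
      moreover have "{q, q'} \<in> pairs VR" using pair_in_pairs AV(1) q by blast
      ultimately have "card (nbrs H {q, q'} - {s}) < t" by (simp add: G_def)
      then show ?thesis using c1 finite_nbrs[of "{q, q'}"]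
        by (cases "s \<in> nbrs H {q, q'}") auto
    qed
    have "R \<noteq> {}" using tR t2 by (intro notI) simp
    then have "cd {q, q'} \<le> t" using each by blast
    moreover have sub: "R \<subseteq> nbrs H {q, q'}" using each by blast
    moreover have "card R \<le> cd {q, q'}" by (rule card_mono[OF finite_nbrs sub])
    ultimately have "card R = cd {q, q'}" "card R = t" using tR by linarith+
    then show "nbrs H {q, q'} = R" "card R = t"
      using card_subset_eq[OF finite_nbrs sub] by simp_all
  qed
  have "\<exists>q q'. q \<in> A \<and> q' \<in> A \<and> q \<noteq> q'"
  proof -
    have "\<not> card A \<le> 1" using k2 A(2) by simp
    moreover have "finite A" using A(1) finA' finite_subset by blast
    ultimately show ?thesis by (metis One_nat_def card_le_Suc0_iff_eq)
  qed
  then have "card R = t" using main(2) by blast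
  moreover have "A \<subseteq> {..<n}" using AV(1) VRlt by blast
  ultimately show ?thesis using nA main(1) by blast
qed

end

section \<open>Exceptional vertices\<close>

text \<open>One more than twice the error term
  \<open>8 * t * t + 4 * t + 2 * t * (5 * t + 1) + 1\<close> at the end of
  \<open>thin_vertex_exc\<close>.\<close>

definition core_min :: "nat \<Rightarrow> nat" where
  "core_min t = 3 + 8 * t + 4 * (t * (5 * t + 1)) + 16 * (t * t)"

text \<open>\<open>T\<close> and \<open>A\<close> are as supplied by \<open>core_exists\<close>.
  \<open>K\<close> and \<open>b\<close> are parameters so that \<open>thin_const\<close> is
  independent of \<open>H\<close> and \<open>n\<close>.\<close>

locale fan_free_core = fan_free +
  fixes T A :: "nat set" and K b :: nat
  assumes cT: "card T = t" and A_sub: "A \<subseteq> {..<n}"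
    and core: "\<And>q q'. q \<in> A \<Longrightarrow> q' \<in> A \<Longrightarrow> q \<noteq> q' \<Longrightarrow> nbrs H {q, q'} = T"
    and E: "card {(a, b). exc a b} \<le> K * n"
    and nA: "n \<le> b * card A" and Amin: "core_min t \<le> card A"
begin

lemma finA: "finite A" using A_sub finite_subset by blast

lemma finT: "finite T" using cT t2 by (intro card_ge_0_finite) simp

lemma A_other: "\<exists>q'\<in>A. q' \<noteq> q"
proof (rule ccontr)
  assume "\<not> ?thesis"
  then have "A \<subseteq> {q}" by blast
  then have "card A \<le> 1" using card_mono[of "{q}" A] by simp
  then show False using Amin by (simp add: core_min_def)
qed

lemma A_T: "A \<inter> T = {}"
proof -
  have False if "q \<in> A" "q \<in> T" for q
  proof -
    obtain q' where "q' \<in> A" "q' \<noteq> q" using A_other by blast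
    then have "q \<in> nbrs H {q, q'}" using core[of q q'] that by auto
    then show False by (simp add: nbrs_def)
  qed
  then show ?thesis by blast
qed

lemma T_sub: "T \<subseteq> {..<n}"
proof -
  obtain q q' where "q \<in> A" "q' \<in> A" "q' \<noteq> q" using A_other by blast
  then show ?thesis using core[of q q'] nbrs_sub by metis
qed

lemma rich_A: "5 * t + 1 \<le> cd {s, q}" if "s \<in> T" "q \<in> A"
proof -
  have "A - {q} \<subseteq> nbrs H {s, q}"
  proof
    fix q' assume "q' \<in> A - {q}"
    then have "s \<in> nbrs H {q, q'}" using core[of q q'] that by auto
    then show "q' \<in> nbrs H {s, q}" by (simp add: in_nbrs insert_commute)
  qed
  then have "card (A - {q}) \<le> cd {s, q}" by (rule card_mono[OF finite_nbrs])
  moreover have "card (A - {q}) = card A - 1" using that finA by simp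
  moreover have "5 * t + 2 \<le> card A" using Amin by (simp add: core_min_def algebra_simps)
  ultimately show ?thesis by linarith
qed

text \<open>The triangles of a fan centred at \<open>s\<close> are indexed by \<open>T\<close>: the
  index \<open>s\<close> takes the given edge as its outer edge, and every other element of
  \<open>T\<close> closes a pair from \<open>A\<close>. All spokes are rich.\<close>

lemma no_extra_edge:
  assumes s: "s \<in> T" and e: "{a, c, z} \<in> H" and out: "a \<notin> T" "c \<notin> T" "z \<notin> T"
    and rich: "5 * t + 1 \<le> cd {s, a}" "5 * t + 1 \<le> cd {s, c}"
  shows False
proof -
  have d: "a \<noteq> c" "a \<noteq> z" "c \<noteq> z" using edge_distinct[OF e] by auto
  have "2 * t \<le> card A - card {a, c, z}" using Amin d by (simp add: core_min_def)
  also have "\<dots> \<le> card (A - {a, c, z})" by (rule diff_card_le_card_Diff) simp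
  finally have c2: "2 * t \<le> card (A - {a, c, z})" .
  obtain u w where uw: "\<And>i. i < t \<Longrightarrow> u i \<in> A - {a, c, z} \<and> w i \<in> A - {a, c, z} \<and> u i \<noteq> w i"
    "\<And>i j. i < t \<Longrightarrow> j < t \<Longrightarrow> i \<noteq> j \<Longrightarrow> {u i, w i} \<inter> {u j, w j} = {}"
    using pair_up[OF _ c2] finA by auto
  obtain h where h: "bij_betw h T {0..<t}" using ex_bij_betw_finite_nat[OF finT] cT by auto
  have hl: "h x < t" if "x \<in> T" for x using bij_betwE[OF h] that by auto
  have hi: "h x \<noteq> h y" if "x \<in> T" "y \<in> T" "x \<noteq> y" for x y
    using bij_betw_imp_inj_on[OF h] that by (auto dest: inj_onD)
  have ua: "u (h x) \<in> A" "w (h x) \<in> A" "u (h x) \<noteq> w (h x)" "u (h x) \<notin> {a, c, z}" "w (h x) \<notin> {a, c, z}"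
    "u (h x) \<notin> T" "w (h x) \<notin> T" if "x \<in> T" for x
    using uw(1)[OF hl[OF that]] A_T by auto
  show False
  proof (rule no_fan_rich_centre[OF finT cT, where v = s and p = "\<lambda>x. if x = s then a else u (h x)"
        and q = "\<lambda>x. if x = s then c else w (h x)" and z = "\<lambda>x. if x = s then z else x"])
    fix x assume x: "x \<in> T"
    note ux = ua[OF x]
    show "distinct [s, if x = s then a else u (h x), if x = s then c else w (h x), if x = s then z else x]"
      using ux d out s x by auto
    show "{if x = s then a else u (h x), if x = s then c else w (h x), if x = s then z else x} \<in> H"
      using e core[OF ux(1-3)] x by (auto simp: in_nbrs[symmetric])
    show "5 * t + 1 \<le> cd {s, if x = s then a else u (h x)}" "5 * t + 1 \<le> cd {s, if x = s then c else w (h x)}"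
      using rich rich_A[OF s ux(1)] rich_A[OF s ux(2)] by auto
  next
    fix x y assume xy: "x \<in> T" "y \<in> T" "x \<noteq> y"
    have dd: "{u (h x), w (h x)} \<inter> {u (h y), w (h y)} = {}"
      by (rule uw(2)[OF hl[OF xy(1)] hl[OF xy(2)] hi[OF xy]])
    show "{if x = s then a else u (h x), if x = s then c else w (h x), if x = s then z else x} \<inter>
        {if y = s then a else u (h y), if y = s then c else w (h y), if y = s then z else y} = {}"
      using ua[OF xy(1)] ua[OF xy(2)] dd xy out by auto
  qed
qed

text \<open>Pairing up the \<open>q i\<close> gives \<open>t\<close> triangles centred at
  \<open>r\<close> with fixed spokes, and the \<open>t\<close> elements of \<open>T\<close> are
  candidates for every outer edge.\<close>

lemma no_spokes_into_T:
  assumes I: "finite I" "2 * t \<le> card I" and r: "r \<notin> T"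
    and edges: "\<And>i. i \<in> I \<Longrightarrow> {r, q i, u i} \<in> H"
    and out: "\<And>i. i \<in> I \<Longrightarrow> q i \<notin> T" "\<And>i. i \<in> I \<Longrightarrow> u i \<notin> T"
    and qu: "inj_on q I" "inj_on u I" "\<And>i j. i \<in> I \<Longrightarrow> j \<in> I \<Longrightarrow> q i \<noteq> u j"
    and link: "\<And>i j. i \<in> I \<Longrightarrow> j \<in> I \<Longrightarrow> i \<noteq> j \<Longrightarrow> nbrs H {q i, q j} = T"
  shows False
proof -
  obtain a c where ac: "\<And>i. i < t \<Longrightarrow> a i \<in> I \<and> c i \<in> I \<and> a i \<noteq> c i"
    "\<And>i j. i < t \<Longrightarrow> j < t \<Longrightarrow> i \<noteq> j \<Longrightarrow> {a i, c i} \<inter> {a j, c j} = {}"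
    using pair_up[OF I] by blast
  have qi: "q i \<noteq> q j" "u i \<noteq> u j" if "i \<in> I" "j \<in> I" "i \<noteq> j" for i j
    using qu(1,2) that by (auto dest: inj_onD)
  have rr: "r \<noteq> q i" "r \<noteq> u i" if "i \<in> I" for i using edge_distinct[OF edges[OF that]] by auto
  show False
  proof (rule no_fan_fixed_spokes[where I = "{..<t}" and v = r and p = "\<lambda>i. q (a i)" and q = "\<lambda>i. q (c i)"
        and x = "\<lambda>i. u (a i)" and y = "\<lambda>i. u (c i)" and Z = "\<lambda>i. T"])
    fix i assume "i \<in> {..<t}"
    then have i: "a i \<in> I" "c i \<in> I" "a i \<noteq> c i" using ac(1) by auto
    show "distinct [r, q (a i), q (c i), u (a i), u (c i)]"
      using rr[OF i(1)] rr[OF i(2)] qi[OF i] qu(3) i by simp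
    show "{r, q (a i), u (a i)} \<in> H" "{r, q (c i), u (c i)} \<in> H" using edges i by auto
    show "T \<subseteq> nbrs H {q (a i), q (c i)} - {r, u (a i), u (c i)}"
      using link[OF i] r out(2)[OF i(1)] out(2)[OF i(2)] by auto
  next
    fix i j assume "i \<in> {..<t}" "j \<in> {..<t}" and ij: "i \<noteq> j"
    then have l: "i < t" "j < t" by auto
    have m: "a i \<in> I" "c i \<in> I" "a j \<in> I" "c j \<in> I" using ac(1) l by auto
    have ne: "a i \<noteq> a j" "a i \<noteq> c j" "c i \<noteq> a j" "c i \<noteq> c j" using ac(2)[OF l ij] by auto
    show "{q (a i), q (c i), u (a i), u (c i)} \<inter> {q (a j), q (c j), u (a j), u (c j)} = {}"
      using qi[OF m(1,3) ne(1)] qi[OF m(1,4) ne(2)] qi[OF m(2,3) ne(3)] qi[OF m(2,4) ne(4)] qu(3) m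
      by (simp add: qu(3)[symmetric])
    show "T \<inter> {q (a j), q (c j), u (a j), u (c j)} = {}" using out m by auto
  qed (simp_all add: cT)
qed

text \<open>The exceptional vertices with respect to \<open>s\<close>, as opposed to the exceptional
  pairs \<open>exc\<close>.\<close>

definition thin :: "nat \<Rightarrow> nat set" where
  "thin s = {r. r < n \<and> r \<notin> T \<and> cd {s, r} < 5 * t + 1}"

definition Thin :: "nat set" where "Thin = (\<Union>s\<in>T. thin s)"

definition thin_const :: nat where "thin_const = 2 * K * b + 4 * (5 * t + 1) * K * b"

lemma thin_sub: "thin s \<subseteq> {..<n}" by (auto simp: thin_def)

text \<open>Otherwise there is a fan centred at \<open>u\<close>: the spokes are rich, and
  \<open>T\<close> closes the outer edges between vertices of \<open>A\<close>.\<close>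

lemma few_rich_outside:
  assumes "u \<notin> T" "u \<notin> A"
  shows "card {q \<in> A. 5 * t + 1 \<le> cd {u, q}} \<le> 2 * t"
proof (rule ccontr)
  assume big: "\<not> ?thesis"
  define B where "B = {q \<in> A. 5 * t + 1 \<le> cd {u, q}}"
  have finB: "finite B" using finA by (simp add: B_def)
  have "2 * t \<le> card B" using big unfolding B_def by linarith
  then obtain a c where ac: "\<And>i. i < t \<Longrightarrow> a i \<in> B \<and> c i \<in> B \<and> a i \<noteq> c i"
    "\<And>i j. i < t \<Longrightarrow> j < t \<Longrightarrow> i \<noteq> j \<Longrightarrow> {a i, c i} \<inter> {a j, c j} = {}"
    using pair_up[OF finB] by blast
  show False
  proof (rule no_fan_rich_centre_lists[where I = "{..<t}" and v = u and p = a and q = c and Z = "\<lambda>i. T"])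
    fix i assume "i \<in> {..<t}"
    then have i: "a i \<in> B" "c i \<in> B" "a i \<noteq> c i" using ac(1) by auto
    then have iA: "a i \<in> A" "c i \<in> A" by (auto simp: B_def)
    show "distinct [u, a i, c i]" using i iA assms by auto
    show "T \<subseteq> nbrs H {a i, c i} - {u}" using core[OF iA i(3)] assms by auto
    show "5 * t + 1 \<le> cd {u, a i}" "5 * t + 1 \<le> cd {u, c i}" using i by (auto simp: B_def)
  next
    fix i j assume "i \<in> {..<t}" "j \<in> {..<t}" and ij: "i \<noteq> j"
    then have l: "i < t" "j < t" by auto
    show "{a i, c i} \<inter> {a j, c j} = {}" by (rule ac(2)[OF l ij])
    show "T \<inter> {a j, c j} = {}" using ac(1)[OF l(2)] A_T by (auto simp: B_def)
  qed (simp_all add: cT)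
qed

text \<open>About half of \<open>A\<close> at least is tight with \<open>r\<close>. For most such
  \<open>p\<close> the neighbours of \<open>{r, p}\<close> avoid \<open>T\<close> and lie in a set
  \<open>U\<close> of fewer than \<open>2 * t\<close> vertices. A neighbour \<open>w p\<close> then
  forms an exceptional pair with \<open>p\<close>, usually of small codegree.\<close>

lemma thin_vertex_exc:
  assumes r: "r \<in> thin s" and s: "s \<in> T" and lowdeg: "2 * card {q. exc r q} < card A"
  shows "card A \<le> 4 * card {(u, q). exc u q \<and> cd {u, q} < 5 * t + 1 \<and> r \<in> nbrs H {u, q}}"
proof -
  define C0 where "C0 = 5 * t + 1"
  have rT: "r < n" "r \<notin> T" "cd {s, r} < C0" using r by (auto simp: thin_def C0_def)
  define A0 where "A0 = {q \<in> A. tight r q}"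
  have finA0: "finite A0" using finA by (simp add: A0_def)
  have fine: "finite {q. exc r q}" by (rule finite_subset[of _ "{..<n}"]) (auto simp: exc_def)
  have cA0: "card A \<le> 2 * card A0 + 1"
  proof -
    have "A \<subseteq> A0 \<union> ({q. exc r q} \<union> {r})"
      using tight_or_exc[OF rT(1)] A_sub by (auto simp: A0_def)
    then have "card A \<le> card (A0 \<union> ({q. exc r q} \<union> {r}))"
      by (rule card_mono[rotated]) (use finA0 fine in simp)
    also have "\<dots> \<le> card A0 + (card {q. exc r q} + card {r})"
      by (meson add_left_mono card_Un_le le_trans)
    finally have "card A \<le> card A0 + (card {q. exc r q} + 1)" by simp
    then show ?thesis using lowdeg by linarith
  qed
  define G where "G = (\<lambda>(q, u). {q, u}) ` {(q, u). q \<in> A0 \<and> u \<in> nbrs H {r, q} - T}"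
  have uA: "u \<notin> A" if "q \<in> A0" "u \<in> nbrs H {r, q}" for q u
  proof
    assume "u \<in> A"
    have e: "{r, q, u} \<in> H" using that(2) by (simp add: in_nbrs)
    then have "r \<in> nbrs H {q, u}" "q \<noteq> u" using edge_nbrs[OF e] edge_distinct[OF e] by auto
    then show False using core[of q u] that(1) \<open>u \<in> A\<close> rT(2) by (auto simp: A0_def)
  qed
  have finG: "finite G"
  proof -
    have "{(q, u). q \<in> A0 \<and> u \<in> nbrs H {r, q} - T} \<subseteq> A0 \<times> {..<n}" using nbrs_sub by blast
    then show ?thesis unfolding G_def using finA0 finite_subset by blast
  qed
  obtain M where M: "M \<subseteq> G" "pairwise disjnt M" "\<forall>e\<in>G. e \<noteq> {} \<longrightarrow> e \<inter> \<Union>M \<noteq> {}"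
    using maximal_matching[OF finG] by blast
  have finM: "finite M" using M(1) finG finite_subset by blast
  have "\<exists>q u. f = {q, u} \<and> q \<in> A0 \<and> u \<in> nbrs H {r, q} - T" if "f \<in> M" for f
  proof -
    have "f \<in> G" using that M(1) by blast
    then show ?thesis unfolding G_def by auto
  qed
  then obtain q u where qu: "\<And>f. f \<in> M \<Longrightarrow> {q f, u f} = f \<and> q f \<in> A0 \<and> u f \<in> nbrs H {r, q f} - T" by metis
  have quf: "q f \<in> A" "u f \<notin> A" "u f \<notin> T" "q f \<notin> T" "q f \<in> f" "u f \<in> f" if "f \<in> M" for f
  proof -
    note * = qu[OF that]
    show "q f \<in> A" using * by (simp add: A0_def)
    then show "q f \<notin> T" using A_T by blast
    show "u f \<notin> A" using uA * by blast
    show "u f \<notin> T" using * by blast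
    show "q f \<in> f" "u f \<in> f" using * by blast+
  qed
  have Mdisj: "f \<inter> g = {}" if "f \<in> M" "g \<in> M" "f \<noteq> g" for f g
    using M(2) that by (auto simp: pairwise_def disjnt_def)
  have qinj: "inj_on q M" "inj_on u M"
    unfolding inj_on_def using quf(5,6) Mdisj by (metis disjoint_iff)+
  have cM: "card M < 2 * t"
  proof (rule ccontr)
    assume "\<not> ?thesis"
    then have c: "2 * t \<le> card M" by simp
    show False
    proof (rule no_spokes_into_T[OF finM c rT(2), where q = q and u = u])
      show "{r, q f, u f} \<in> H" if "f \<in> M" for f using qu[OF that] in_nbrs by blast
      show "q f \<noteq> u g" if "f \<in> M" "g \<in> M" for f g using quf(1)[OF that(1)] quf(2)[OF that(2)] by auto
      show "nbrs H {q f, q g} = T" if "f \<in> M" "g \<in> M" "f \<noteq> g" for f g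
        using core[OF quf(1)[OF that(1)] quf(1)[OF that(2)]] inj_onD[OF qinj(1) _ that(1,2)] that(3) by blast
    qed (use quf qinj in auto)
  qed
  define W where "W = q ` M"
  define U where "U = u ` M"
  have cW: "card W < 2 * t" "card U < 2 * t"
    using card_image_le[OF finM, of q] card_image_le[OF finM, of u] cM by (auto simp: W_def U_def)
  have finW: "finite W" "finite U" using finM by (auto simp: W_def U_def)
  have UM: "\<Union>M \<subseteq> W \<union> U"
  proof
    fix x assume "x \<in> \<Union>M"
    then obtain f where "f \<in> M" "x \<in> f" by blast
    then show "x \<in> W \<union> U" using qu[of f] by (auto simp: W_def U_def)
  qed
  have WU: "W \<subseteq> A" "U \<inter> A = {}" "U \<inter> T = {}" using quf by (auto simp: W_def U_def)
  have toU: "nbrs H {r, p} - T \<subseteq> U" if "p \<in> A0 - W" for p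
  proof
    fix v assume v: "v \<in> nbrs H {r, p} - T"
    have "{p, v} \<in> G" unfolding G_def using v that by (intro image_eqI[where x = "(p, v)"]) auto
    from M(3)[THEN bspec, OF this] have "{p, v} \<inter> \<Union>M \<noteq> {}" by simp
    then have "p \<in> W \<union> U \<or> v \<in> W \<union> U" using UM by blast
    moreover have "v \<notin> A" using uA[of p v] v that by blast
    moreover have "p \<in> A" using that by (simp add: A0_def)
    ultimately show "v \<in> U" using WU that by blast
  qed
  \<comment> \<open>After removal of \<open>B1\<close>, every \<open>s'\<close> in \<open>T\<close>
    that forms an edge with \<open>r\<close> and \<open>p\<close> is rich with \<open>r\<close>, so
    \<open>no_extra_edge\<close> becomes applicable.\<close>
  define B1 where "B1 = (\<Union>s\<in>{s \<in> T. cd {s, r} < C0}. nbrs H {s, r})"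
  have cB1: "card B1 \<le> t * C0"
  proof -
    have "card B1 \<le> (\<Sum>s\<in>{s \<in> T. cd {s, r} < C0}. cd {s, r})"
      unfolding B1_def by (rule card_UN_le) (simp add: finT)
    also have "\<dots> \<le> (\<Sum>s\<in>{s \<in> T. cd {s, r} < C0}. C0)" by (rule sum_mono) auto
    also have "\<dots> \<le> card T * C0" using card_mono[OF finT, of "{s \<in> T. cd {s, r} < C0}"] by simp
    finally show ?thesis using cT by simp
  qed
  have finB1: "finite B1" using finT finite_nbrs by (simp add: B1_def)
  define A3 where "A3 = A0 - W - B1"
  have A3: "nbrs H {r, p} \<subseteq> U" if p: "p \<in> A3" for p
  proof -
    have pA: "p \<in> A" "tight r p" "p \<notin> B1" "p \<in> A0 - W" using p by (auto simp: A3_def A0_def)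
    have "nbrs H {r, p} \<inter> T = {}"
    proof (rule ccontr)
      assume "nbrs H {r, p} \<inter> T \<noteq> {}"
      then obtain s' where s': "s' \<in> T" "s' \<in> nbrs H {r, p}" by blast
      have "p \<in> nbrs H {s', r}" using s'(2) by (simp add: in_nbrs insert_commute)
      then have rs': "C0 \<le> cd {s', r}" using pA(3) s'(1) by (auto simp: B1_def not_less)
      \<comment> \<open>Tightness gives at least \<open>t\<close> neighbours, so a neighbourhood
        inside \<open>T\<close> would be all of \<open>T\<close>. It would contain \<open>s\<close>,
        for which \<open>r\<close> is thin, contrary to \<open>p \<notin> B1\<close>.\<close>
      have "\<not> nbrs H {r, p} \<subseteq> T"
      proof
        assume sub: "nbrs H {r, p} \<subseteq> T"
        have "nbrs H {r, p} = T"
          using card_seteq[OF finT sub] tight_codegree(1)[OF pA(2)] cT by simp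
        then have "s \<in> nbrs H {r, p}" using s by simp
        then have "p \<in> nbrs H {s, r}" by (simp add: in_nbrs insert_commute)
        then show False using pA(3) s rT(3) by (auto simp: B1_def)
      qed
      then obtain v where v: "v \<in> nbrs H {r, p}" "v \<notin> T" by blast
      then have "{r, p, v} \<in> H" by (simp add: in_nbrs)
      moreover have "p \<notin> T" using pA(1) A_T by blast
      ultimately show False
        using no_extra_edge[OF s'(1), of r p v] rT(2) v(2) rs' rich_A[OF s'(1) pA(1)] by (simp add: C0_def)
    qed
    then show ?thesis using toU[OF pA(4)] by blast
  qed
  have "\<exists>v. v \<in> nbrs H {r, p}" if "p \<in> A3" for p
  proof -
    have "t \<le> cd {r, p}" using that tight_codegree(1) by (simp add: A3_def A0_def)
    then have "nbrs H {r, p} \<noteq> {}" using t2 by (intro notI) simp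
    then show ?thesis by blast
  qed
  then obtain w where w: "\<And>p. p \<in> A3 \<Longrightarrow> w p \<in> nbrs H {r, p}" by metis
  have wexc: "exc (w p) p" "r \<in> nbrs H {w p, p}" "w p \<in> U" if p: "p \<in> A3" for p
  proof -
    have e: "{r, p, w p} \<in> H" using w[OF p] by (simp add: in_nbrs)
    show "w p \<in> U" using A3[OF p] w[OF p] by blast
    show "r \<in> nbrs H {w p, p}" using edge_nbrs[OF e] by (simp add: insert_commute)
    have tp: "tight r p" using p by (simp add: A3_def A0_def)
    \<comment> \<open>By \<open>two_tight\<close> a second tight pair in this edge would require
      \<open>2 * t\<close> neighbours of \<open>{r, p}\<close> inside \<open>U\<close>.\<close>
    have "\<not> tight p (w p)"
    proof
      assume "tight p (w p)"
      from two_tight[OF e tp this] have "2 * t \<le> cd {r, p}" .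
      moreover have "cd {r, p} \<le> card U" by (rule card_mono[OF finW(2) A3[OF p]])
      ultimately show False using cW(2) by linarith
    qed
    then show "exc (w p) p"
      using tight_or_exc[of p "w p"] edge_less[OF e] edge_distinct[OF e] exc_sym by blast
  qed
  define A4 where "A4 = {p \<in> A3. cd {w p, p} < C0}"
  have finA3: "finite A3" using finA0 by (simp add: A3_def)
  have cA4: "card A3 \<le> card A4 + 4 * (t * t)"
  proof -
    have "A3 \<subseteq> A4 \<union> (\<Union>v\<in>U. {p \<in> A. 5 * t + 1 \<le> cd {v, p}})"
    proof
      fix p assume p: "p \<in> A3"
      show "p \<in> A4 \<union> (\<Union>v\<in>U. {p \<in> A. 5 * t + 1 \<le> cd {v, p}})"
      proof (cases "cd {w p, p} < C0")
        case True
        then show ?thesis using p by (simp add: A4_def)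
      next
        case False
        then have "5 * t + 1 \<le> cd {w p, p}" by (simp add: C0_def)
        moreover have "p \<in> A" using p by (simp add: A3_def A0_def)
        ultimately have "p \<in> (\<Union>v\<in>U. {p \<in> A. 5 * t + 1 \<le> cd {v, p}})"
          by (intro UN_I[OF wexc(3)[OF p]]) simp
        then show ?thesis by (rule UnI2)
      qed
    qed
    then have "card A3 \<le> card (A4 \<union> (\<Union>v\<in>U. {p \<in> A. 5 * t + 1 \<le> cd {v, p}}))"
      by (rule card_mono[rotated]) (use finA3 finW finA in \<open>simp add: A4_def\<close>)
    also have "\<dots> \<le> card A4 + card (\<Union>v\<in>U. {p \<in> A. 5 * t + 1 \<le> cd {v, p}})" by (rule card_Un_le)
    also have "card (\<Union>v\<in>U. {p \<in> A. 5 * t + 1 \<le> cd {v, p}}) \<le> (\<Sum>v\<in>U. card {p \<in> A. 5 * t + 1 \<le> cd {v, p}})"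
      by (rule card_UN_le[OF finW(2)])
    also have "\<dots> \<le> (\<Sum>v\<in>U. 2 * t)" by (rule sum_mono, rule few_rich_outside) (use WU in auto)
    also have "\<dots> \<le> (2 * t) * (2 * t)" using cW(2) by simp
    finally show ?thesis by simp
  qed
  have "card A0 - card (W \<union> B1) \<le> card (A0 - (W \<union> B1))"
    by (rule diff_card_le_card_Diff) (use finW finB1 in simp)
  moreover have "card (W \<union> B1) \<le> 2 * t + t * C0" using card_Un_le[of W B1] cW(1) cB1 by linarith
  moreover have "A0 - (W \<union> B1) = A3" by (auto simp: A3_def)
  ultimately have cA3: "card A0 \<le> card A3 + (2 * t + t * C0)" by simp
  let ?F = "{(u, q). exc u q \<and> cd {u, q} < 5 * t + 1 \<and> r \<in> nbrs H {u, q}}"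
  have "card A4 \<le> card ?F"
  proof (rule card_inj_on_le[where f = "\<lambda>p. (w p, p)"])
    show "inj_on (\<lambda>p. (w p, p)) A4" by (simp add: inj_on_def)
    show "(\<lambda>p. (w p, p)) ` A4 \<subseteq> ?F" using wexc by (auto simp: A4_def C0_def)
    show "finite ?F" by (rule finite_subset[OF _ finite_exc]) auto
  qed
  moreover define tc tt where "tc = t * C0" and "tt = t * t"
  ultimately have "card A \<le> 2 * card ?F + 8 * tt + 4 * t + 2 * tc + 1"
    using cA0 cA3[folded tc_def] cA4[folded tt_def] by linarith
  moreover have "core_min t = 3 + 8 * t + 4 * tc + 16 * tt"
    by (simp add: core_min_def C0_def tc_def tt_def)
  ultimately show ?thesis using Amin by linarith
qed

text \<open>Vertices with at least \<open>card A / 2\<close> exceptional partners are boundedly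
  many, because there are \<open>O(n)\<close> exceptional pairs and \<open>A\<close> is linear in
  \<open>n\<close>. Each other thin vertex is a neighbour of \<open>card A / 4\<close> exceptional
  pairs of codegree at most \<open>5 * t\<close>, and double counting bounds their number.\<close>

lemma card_Thin: "card Thin \<le> thin_const"
proof -
  define X1 where "X1 = {r \<in> {..<n}. card A \<le> 2 * card {q. exc r q}}"
  define X2 where "X2 = Thin - X1"
  have Apos: "0 < card A" using Amin by (simp add: core_min_def)
  have fine: "finite {q. exc r q}" for r by (rule finite_subset[of _ "{..<n}"]) (auto simp: exc_def)
  have "card X1 * card A \<le> (2 * K * b) * card A"
  proof -
    have "card X1 * card A \<le> (\<Sum>r\<in>X1. 2 * card {q. exc r q})"
      using sum_bounded_below[of X1 "card A" "\<lambda>r. 2 * card {q. exc r q}"] by (auto simp: X1_def)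
    also have "\<dots> \<le> (\<Sum>r<n. 2 * card {q. exc r q})" by (rule sum_mono2) (auto simp: X1_def)
    also have "\<dots> = 2 * card (Sigma {..<n} (\<lambda>r. {q. exc r q}))" using fine by (simp add: sum_distrib_left)
    also have "Sigma {..<n} (\<lambda>r. {q. exc r q}) = {(a, b). exc a b}" by (auto simp: exc_def)
    also have "2 * card {(a, b). exc a b} \<le> 2 * (K * (b * card A))"
      using E nA by (meson le_trans mult_le_mono2)
    finally show ?thesis by (simp only: mult.assoc)
  qed
  then have c1: "card X1 \<le> 2 * K * b" using Apos by (metis mult_le_cancel2)
  define F where "F = {(u, q). exc u q \<and> cd {u, q} < 5 * t + 1}"
  have finF: "finite F" unfolding F_def by (rule finite_subset[OF _ finite_exc]) auto
  have Thin_sub: "Thin \<subseteq> {..<n}" using thin_sub by (auto simp: Thin_def)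
  have finX2: "finite X2" using Thin_sub finite_subset by (auto simp: X2_def)
  have "card X2 * card A \<le> (4 * (5 * t + 1) * K * b) * card A"
  proof -
    have each: "card A \<le> 4 * card {e \<in> F. r \<in> nbrs H {fst e, snd e}}" if "r \<in> X2" for r
    proof -
      obtain s where s: "s \<in> T" "r \<in> thin s" using \<open>r \<in> X2\<close> by (auto simp: X2_def Thin_def)
      have "2 * card {q. exc r q} < card A" using that Thin_sub by (auto simp: X2_def X1_def)
      from thin_vertex_exc[OF s(2,1) this]
      have "card A \<le> 4 * card {(u, q). exc u q \<and> cd {u, q} < 5 * t + 1 \<and> r \<in> nbrs H {u, q}}" .
      also have "{(u, q). exc u q \<and> cd {u, q} < 5 * t + 1 \<and> r \<in> nbrs H {u, q}}
        = {e \<in> F. r \<in> nbrs H {fst e, snd e}}" by (auto simp: F_def)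
      finally show ?thesis .
    qed
    have "card X2 * card A \<le> (\<Sum>r\<in>X2. 4 * card {e \<in> F. r \<in> nbrs H {fst e, snd e}})"
      using sum_bounded_below[of X2 "card A" "\<lambda>r. 4 * card {e \<in> F. r \<in> nbrs H {fst e, snd e}}"] each by simp
    also have "\<dots> = 4 * (\<Sum>r\<in>X2. card {e \<in> F. r \<in> nbrs H {fst e, snd e}})" by (simp add: sum_distrib_left)
    also have "(\<Sum>r\<in>X2. card {e \<in> F. r \<in> nbrs H {fst e, snd e}})
      = (\<Sum>e\<in>F. card {r \<in> X2. r \<in> nbrs H {fst e, snd e}})"
      by (rule sum_multicount_gen) (use finX2 finF in auto)
    also have "\<dots> \<le> (\<Sum>e\<in>F. 5 * t + 1)"
    proof (rule sum_mono)
      fix e assume "e \<in> F"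
      then have "cd {fst e, snd e} < 5 * t + 1" by (auto simp: F_def)
      moreover have "card {r \<in> X2. r \<in> nbrs H {fst e, snd e}} \<le> cd {fst e, snd e}"
        by (rule card_mono[OF finite_nbrs]) auto
      ultimately show "card {r \<in> X2. r \<in> nbrs H {fst e, snd e}} \<le> 5 * t + 1" by linarith
    qed
    finally have "card X2 * card A \<le> 4 * (card F * (5 * t + 1))" by simp
    moreover have "card F \<le> K * (b * card A)"
    proof -
      have "card F \<le> card {(a, b). exc a b}" by (rule card_mono[OF finite_exc]) (auto simp: F_def)
      then show ?thesis using E nA by (meson le_trans mult_le_mono2)
    qed
    then have "4 * (card F * (5 * t + 1)) \<le> 4 * (K * (b * card A) * (5 * t + 1))"
      by (intro mult_le_mono) auto
    ultimately have "card X2 * card A \<le> 4 * (K * (b * card A) * (5 * t + 1))" by (rule le_trans)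
    also have "\<dots> = (4 * (5 * t + 1) * K * b) * card A" by (simp only: ac_simps)
    finally show ?thesis .
  qed
  then have c2: "card X2 \<le> 4 * (5 * t + 1) * K * b" using Apos by (metis mult_le_cancel2)
  have "card Thin \<le> card (X1 \<union> X2)"
    by (rule card_mono) (use finX2 in \<open>auto simp: X1_def X2_def\<close>)
  then show ?thesis using card_Un_le[of X1 X2] c1 c2 unfolding thin_const_def by linarith
qed

end

section \<open>The extremal number\<close>

definition star :: "nat \<Rightarrow> nat set \<Rightarrow> nat set set" where
  "star n T = {e. e \<subseteq> {..<n} \<and> card e = 3 \<and> e \<inter> T \<noteq> {}}"

lemma finite_star: "finite (star n T)"
  by (rule finite_subset[of _ "Pow {..<n}"]) (auto simp: star_def)

lemma card_star:
  assumes "T \<subseteq> {..<n}"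
  shows "card (star n T) = (n choose 3) - ((n - card T) choose 3)"
proof -
  let ?all = "{e. e \<subseteq> {..<n} \<and> card e = 3}" and ?out = "{e. e \<subseteq> {..<n} - T \<and> card e = 3}"
  have fin: "finite ?out" by (rule finite_subset[of _ "Pow {..<n}"]) auto
  have "star n T = ?all - ?out" by (auto simp: star_def)
  then have "card (star n T) = card ?all - card ?out"
    using card_Diff_subset[OF fin, of ?all] by auto
  moreover have "card ({..<n} - T) = n - card T"
    using assms finite_subset[OF assms] by (simp add: card_Diff_subset)
  ultimately show ?thesis using n_subsets[of "{..<n}" 3] n_subsets[of "{..<n} - T" 3] by simp
qed

text \<open>No \<open>t\<close> vertices meet all edges of the expanded fan: besides the centre one needs a vertex of each outer
  edge, and without the centre one needs a further vertex of each of the \<open>2t\<close> spokes.\<close>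
lemma star_fan_free:
  assumes "0 < t"
  shows "\<not> contains (star n {..<t}) (expansion 3 (fan t))"
proof
  assume "contains (star n {..<t}) (expansion 3 (fan t))"
  then obtain f where f: "inj_on f (\<Union>(expansion 3 (fan t)))"
    "\<forall>e\<in>expansion 3 (fan t). f ` e \<in> star n {..<t}" unfolding contains_def by auto
  have hit: "\<exists>w\<in>e. f w < t" if "e \<in> expansion 3 (fan t)" for e
  proof -
    have "f ` e \<inter> {..<t} \<noteq> {}" using f(2) that by (simp add: star_def)
    then show ?thesis by auto
  qed
  define outer :: "nat \<Rightarrow> (nat + nat set \<times> nat) set" where
    "outer i = {Inl (2 * i + 1), Inl (2 * i + 2), Inr ({2 * i + 1, 2 * i + 2}, 0)}" for i
  define spoke :: "nat \<Rightarrow> (nat + nat set \<times> nat) set" where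
    "spoke j = {Inl j, Inr ({0, j}, 0)}" for j
  have outer: "outer i \<in> expansion 3 (fan t)" if "i < t" for i
    unfolding expansion_fan outer_def using that by blast
  have spoke: "insert (Inl 0) (spoke j) \<in> expansion 3 (fan t)" if "j \<in> {1..2 * t}" for j
  proof -
    have "\<exists>i<t. j = 2 * i + 1 \<or> j = 2 * i + 2"
      using that by (intro exI[of _ "(j - 1) div 2"]) auto
    then obtain i where "i < t" "j = 2 * i + 1 \<or> j = 2 * i + 2" by blast
    then show ?thesis unfolding expansion_fan spoke_def by blast
  qed
  have inV: "w \<in> \<Union>(expansion 3 (fan t))" if "e \<in> expansion 3 (fan t)" "w \<in> e" for e w
    using that by blast
  have fi: "w = w'" if "e \<in> expansion 3 (fan t)" "w \<in> e" "e' \<in> expansion 3 (fan t)" "w' \<in> e'" "f w = f w'"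
    for e e' w w'
    using inj_onD[OF f(1) that(5) inV[OF that(1,2)] inV[OF that(3,4)]] .
  show False
  proof (cases "f (Inl 0) < t")
    case True
    obtain w where w: "\<And>i. i < t \<Longrightarrow> w i \<in> outer i \<and> f (w i) < t" using hit[OF outer] by metis
    have "inj_on (\<lambda>i. f (w i)) {..<t}"
    proof (rule inj_onI)
      fix i j assume ij: "i \<in> {..<t}" "j \<in> {..<t}" "f (w i) = f (w j)"
      then have "w i = w j" using fi[of "outer i" "w i" "outer j" "w j"] outer w by auto
      then have "outer i \<inter> outer j \<noteq> {}" using w[of i] w[of j] ij by auto
      then show "i = j" unfolding outer_def by (auto simp: doubleton_eq_iff)
    qed
    moreover have "f (w i) \<noteq> f (Inl 0)" if "i < t" for i
    proof
      assume eq: "f (w i) = f (Inl 0)"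
      have "insert (Inl 0) (spoke 1) \<in> expansion 3 (fan t)" using spoke[of 1] assms by simp
      then have "w i = Inl 0"
        using fi[of "outer i" "w i" "insert (Inl 0) (spoke 1)" "Inl 0"] eq outer[OF that] w[OF that] by simp
      then show False using w[OF that] by (auto simp: outer_def)
    qed
    then have "(\<lambda>i. f (w i)) ` {..<t} \<subseteq> {..<t} - {f (Inl 0)}" using w by auto
    ultimately have "card {..<t} \<le> card ({..<t} - {f (Inl 0)})" by (intro card_inj_on_le) auto
    then show False using True by simp
  next
    case False
    have "\<exists>w\<in>spoke j. f w < t" if "j \<in> {1..2 * t}" for j
      using hit[OF spoke[OF that]] False by auto
    then obtain w where w: "\<And>j. j \<in> {1..2 * t} \<Longrightarrow> w j \<in> spoke j \<and> f (w j) < t" by metis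
    have "inj_on (\<lambda>j. f (w j)) {1..2 * t}"
    proof (rule inj_onI)
      fix i j assume ij: "i \<in> {1..2 * t}" "j \<in> {1..2 * t}" "f (w i) = f (w j)"
      then have "w i = w j"
        using fi[of "insert (Inl 0) (spoke i)" "w i" "insert (Inl 0) (spoke j)" "w j"] spoke w by blast
      then have "spoke i \<inter> spoke j \<noteq> {}" using w[OF ij(1)] w[OF ij(2)] by auto
      then show "i = j" unfolding spoke_def by (auto simp: doubleton_eq_iff)
    qed
    moreover have "(\<lambda>j. f (w j)) ` {1..2 * t} \<subseteq> {..<t}" using w by auto
    ultimately have "card {1..2 * t} \<le> card {..<t}" by (intro card_inj_on_le) auto
    then show False using assms by simp
  qed
qed

section \<open>Edges avoiding \<open>T\<close> against triples missing at thin vertices\<close>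

context fan_free_core
begin

lemma thin_T: "thin s \<inter> T = {}" by (auto simp: thin_def)

text \<open>Two vertices of \<open>e\<close> outside \<open>thin s\<close> would both be rich with
  \<open>s\<close>, contrary to \<open>no_extra_edge\<close>.\<close>

lemma extra_edge_thin:
  assumes e: "e \<in> H" "e \<inter> T = {}" and s: "s \<in> T"
  shows "2 \<le> card (e \<inter> thin s)"
proof (rule ccontr)
  assume "\<not> ?thesis"
  moreover have "card e = card (e \<inter> thin s) + card (e - thin s)"
    using finite_edge[OF e(1)] by (metis card_Int_Diff)
  ultimately have "2 \<le> card (e - thin s)" using edgeD(2)[OF e(1)] by linarith
  then obtain P where P: "P \<subseteq> e - thin s" "card P = 2" by (metis obtain_subset_with_card_n)
  then obtain a c where ac: "P = {a, c}" "a \<noteq> c" by (auto simp: card_2_iff)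
  have "card (e - P) = 1" using P edgeD(2)[OF e(1)] finite_edge[OF e(1)]
    by (subst card_Diff_subset) (auto simp: ac)
  then obtain z where "e - P = {z}" by (auto simp: card_1_singleton_iff)
  then have eq: "e = {a, c, z}" using P ac by auto
  have rich: "5 * t + 1 \<le> cd {s, x}" if "x \<in> P" for x
  proof -
    have "x \<in> e" "x \<notin> thin s" using that P by auto
    then show ?thesis using edgeD(1)[OF e(1)] e(2) by (auto simp: thin_def not_less)
  qed
  show False
    using no_extra_edge[OF s, of a c z] e eq rich[of a] rich[of c] ac by auto
qed

definition Y :: "nat set" where "Y = {..<n} - T - Thin"

lemma finite_Y: "finite Y" by (simp add: Y_def)

text \<open>A neighbour outside \<open>T\<close> would create an edge avoiding \<open>T\<close> with
  at most one thin vertex.\<close>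

lemma link_Y:
  assumes y: "y \<in> Y" "y' \<in> Y" "tight y y'"
  shows "nbrs H {y, y'} = T"
proof -
  obtain s where s: "s \<in> T" using cT t2 by (metis card.empty ex_in_conv not_numeral_le_zero)
  have "nbrs H {y, y'} \<subseteq> T"
  proof (rule subsetI, rule ccontr)
    fix z assume z: "z \<in> nbrs H {y, y'}" "z \<notin> T"
    then have e: "{y, y', z} \<in> H" by (simp add: in_nbrs)
    moreover have "{y, y', z} \<inter> T = {}" using y z by (auto simp: Y_def)
    ultimately have "2 \<le> card ({y, y', z} \<inter> thin s)" by (rule extra_edge_thin[OF _ _ s])
    moreover have "{y, y', z} \<inter> thin s \<subseteq> {z}" using y s by (auto simp: Y_def Thin_def)
    then have "card ({y, y', z} \<inter> thin s) \<le> card {z}" by (rule card_mono[rotated]) simp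
    ultimately show False by simp
  qed
  then show ?thesis using card_seteq[OF finT] tight_codegree(1)[OF y(3)] cT by simp
qed

text \<open>Otherwise \<open>2 * t\<close> pairwise tight such \<open>y\<close> exist, and distinct
  representatives in \<open>S\<close> give the spokes excluded by \<open>no_spokes_into_T\<close>.
  Through \<open>h\<close> the bound is an arbitrarily small fraction of \<open>n\<close>.\<close>

lemma few_rich_spokes:
  assumes r: "r \<notin> T" and S: "S \<subseteq> Thin" and n: "h * (4 * t * (4 * (K * h) + 1)) \<le> n"
  shows "h * card {y \<in> Y. 2 * t \<le> card (nbrs H {r, y} \<inter> S)} \<le> n"
proof (rule ccontr)
  assume "\<not> ?thesis"
  moreover define I where "I = {y \<in> Y. 2 * t \<le> card (nbrs H {r, y} \<inter> S)}"
  ultimately have big: "n < h * card I" by simp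
  have finI: "finite I" using finite_Y by (simp add: I_def)
  have ThinT: "Thin \<inter> T = {}" using thin_T by (auto simp: Thin_def)
  have "h * (4 * t * (4 * (K * h) + 1)) < h * card I" using n big by linarith
  then have c: "2 * (2 * t) * (4 * (K * h) + 1) \<le> card I" by simp
  have "card {(y, y') \<in> I \<times> I. exc y y'} \<le> card {(a, b). exc a b}"
    by (rule card_mono[OF finite_exc]) auto
  also have "\<dots> \<le> K * (h * card I)" using E big by (meson le_trans less_imp_le mult_le_mono2)
  finally have "card {(y, y') \<in> I \<times> I. exc y y'} \<le> K * h * card I" by (simp add: mult.assoc)
  from select_sparse[OF finI this c] obtain J where J: "J \<subseteq> I" "card J = 2 * t"
    "\<And>i j. i \<in> J \<Longrightarrow> j \<in> J \<Longrightarrow> i \<noteq> j \<Longrightarrow> \<not> exc i j" by blast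
  have finJ: "finite J" using J(1) finI finite_subset by blast
  have JY: "y \<in> Y" "2 * t \<le> card (nbrs H {r, y} \<inter> S)" if "y \<in> J" for y
    using that J(1) by (auto simp: I_def)
  obtain u where u: "inj_on u J" "\<And>y. y \<in> J \<Longrightarrow> u y \<in> nbrs H {r, y} \<inter> S"
    using uniform_sdr[OF finJ, of "\<lambda>y. nbrs H {r, y} \<inter> S"] finite_nbrs JY(2) J(2) by auto
  show False
  proof (rule no_spokes_into_T[OF finJ _ r, where q = "\<lambda>y. y" and u = u])
    fix y assume y: "y \<in> J"
    show "{r, y, u y} \<in> H" using u(2)[OF y] by (simp add: in_nbrs)
    show "y \<notin> T" using JY(1)[OF y] by (simp add: Y_def)
    show "u y \<notin> T" using u(2)[OF y] S ThinT by blast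
  next
    fix y y' assume y: "y \<in> J" "y' \<in> J"
    show "y \<noteq> u y'" using JY(1)[OF y(1)] u(2)[OF y(2)] S by (auto simp: Y_def)
    assume ne: "y \<noteq> y'"
    have "tight y y'" using tight_or_exc[of y y'] J(3)[OF y ne] ne JY(1) y by (auto simp: Y_def)
    then show "nbrs H {y, y'} = T" by (rule link_Y[OF JY(1)[OF y(1)] JY(1)[OF y(2)]])
  qed (use J(2) u(1) in auto)
qed

text \<open>With \<open>k\<close> the least size of a set \<open>thin s\<close>, at most about
  \<open>k * (t - 3/8) * n\<close> edges avoid \<open>T\<close>, while about
  \<open>k * t * n\<close> triples of the star are missing from \<open>H\<close>. All estimates
  carry the factor \<open>k\<close>, so \<open>k = 0\<close> is no special case.\<close>

lemma card_H_le:
  assumes n: "4 * thin_const * (4 * t * (4 * (K * (4 * thin_const)) + 1)) \<le> n"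
    "8 * (thin_const * thin_const) + 8 * (t * (5 * t + 1)) + 8 * (t * t) + 8 * (t * thin_const) + t + thin_const \<le> n"
  shows "card H \<le> (n choose 3) - ((n - t) choose 3)"
proof -
  define k0 where "k0 = thin_const"
  have finThin: "finite Thin" by (rule finite_subset[of _ "{..<n}"]) (auto simp: Thin_def thin_def)
  have cThin: "card Thin \<le> k0" using card_Thin by (simp add: k0_def)
  have T_ne: "T \<noteq> {}" using cT t2 by auto
  \<comment> \<open>Minimality guarantees that every \<open>thin s\<close> can supply
    \<open>k\<close> vertices in \<open>cT'\<close>.\<close>
  obtain s0 where s0: "s0 \<in> T" "\<And>s. s \<in> T \<Longrightarrow> card (thin s0) \<le> card (thin s)"
    using ex_min_if_finite[of "(\<lambda>s. card (thin s)) ` T"] finT T_ne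
    by (metis arg_min_if_finite(1) arg_min_least)
  define S where "S = thin s0"
  define k where "k = card S"
  have S_sub: "S \<subseteq> Thin" using s0(1) by (auto simp: S_def Thin_def)
  have finS: "finite S" using S_sub finThin finite_subset by blast
  have kk0: "k \<le> k0" using card_mono[OF finThin S_sub] cThin by (simp add: k_def)
  define X where "X = {e \<in> H. e \<inter> T = {}}"
  define X2 where "X2 = {e \<in> X. e \<inter> Y \<noteq> {}}"
  define X1 where "X1 = X - X2"
  have finX: "finite X" "finite X1" "finite X2" using finite_H by (auto simp: X_def X1_def X2_def)
  have XS: "2 \<le> card (e \<inter> S)" if "e \<in> X" for e
    using extra_edge_thin[OF _ _ s0(1)] that by (simp add: X_def S_def)
  have cX1: "card X1 \<le> k * (k0 * k0)"
  proof -
    have "X1 \<subseteq> (\<lambda>(r, u, w). {r, u, w}) ` (S \<times> Thin \<times> Thin)"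
    proof
      fix e assume e: "e \<in> X1"
      then have eX: "e \<in> H" "e \<inter> T = {}" "e \<inter> Y = {}" "e \<in> X" by (auto simp: X1_def X2_def X_def)
      have sub: "e \<subseteq> Thin" using edgeD(1)[OF eX(1)] eX(2,3) by (auto simp: Y_def)
      have "e \<inter> S \<noteq> {}" using XS[OF eX(4)] by auto
      then obtain r where r: "r \<in> e" "r \<in> S" by blast
      have "card (e - {r}) = 2" using edgeD(2)[OF eX(1)] r finite_edge[OF eX(1)] by simp
      then obtain u w where "e - {r} = {u, w}" by (auto simp: card_2_iff)
      then have "e = {r, u, w}" using r by auto
      then show "e \<in> (\<lambda>(r, u, w). {r, u, w}) ` (S \<times> Thin \<times> Thin)"
        using r sub by (intro image_eqI[where x = "(r, u, w)"]) auto
    qed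
    then have "card X1 \<le> card (S \<times> Thin \<times> Thin)"
      by (intro order_trans[OF card_mono card_image_le]) (use finS finThin in auto)
    also have "\<dots> = k * (card Thin * card Thin)" by (simp add: card_cartesian_product k_def)
    also have "\<dots> \<le> k * (k0 * k0)" using cThin by (intro mult_le_mono) auto
    finally show ?thesis .
  qed
  \<comment> \<open>An edge of \<open>X2\<close> consists of two vertices of \<open>S\<close> and
    one of \<open>Y\<close>; it is counted once for each order of the former two.\<close>
  define Orb where "Orb = Sigma S (\<lambda>r. Sigma Y (\<lambda>y. nbrs H {r, y} \<inter> S))"
  have finOrb: "finite Orb" using finS finite_Y by (auto simp: Orb_def)
  have cOrb: "4 * card Orb \<le> k * ((8 * t - 3) * n)"
  proof -
    \<comment> \<open>Each \<open>y\<close> contributes at most \<open>2 * t - 1\<close>, except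
      those in \<open>?R\<close>, whose extra contribution is at most \<open>n / 4\<close> in
      total.\<close>
    have each: "4 * (\<Sum>y\<in>Y. card (nbrs H {r, y} \<inter> S)) \<le> (8 * t - 3) * n" if r: "r \<in> S" for r
    proof -
      let ?R = "{y \<in> Y. 2 * t \<le> card (nbrs H {r, y} \<inter> S)}"
      have le_k: "card (nbrs H {r, y} \<inter> S) \<le> k" for y unfolding k_def by (rule card_mono[OF finS]) simp
      have "(\<Sum>y\<in>Y. card (nbrs H {r, y} \<inter> S)) \<le> (\<Sum>y\<in>Y. (2 * t - 1) + (if y \<in> ?R then k0 else 0))"
      proof (rule sum_mono)
        fix y assume y: "y \<in> Y"
        show "card (nbrs H {r, y} \<inter> S) \<le> (2 * t - 1) + (if y \<in> ?R then k0 else 0)"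
        proof (cases "2 * t \<le> card (nbrs H {r, y} \<inter> S)")
          case True
          moreover have "card (nbrs H {r, y} \<inter> S) \<le> k0" using le_k[of y] kk0 by linarith
          ultimately show ?thesis using y by simp
        qed simp
      qed
      also have "\<dots> = card Y * (2 * t - 1) + card ?R * k0"
        using finite_Y by (simp add: sum.distrib sum.If_cases Int_def)
      also have "\<dots> \<le> n * (2 * t - 1) + card ?R * k0"
      proof -
        have "card Y \<le> card {..<n}" by (rule card_mono) (auto simp: Y_def)
        then show ?thesis by simp
      qed
      finally have "(\<Sum>y\<in>Y. card (nbrs H {r, y} \<inter> S)) \<le> n * (2 * t - 1) + card ?R * k0" .
      moreover have "4 * k0 * card ?R \<le> n"
        by (rule few_rich_spokes[OF _ S_sub]) (use r n(1) in \<open>auto simp: S_def thin_def k0_def\<close>)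
      then have "4 * (card ?R * k0) \<le> n" by (simp only: ac_simps)
      ultimately have "4 * (\<Sum>y\<in>Y. card (nbrs H {r, y} \<inter> S)) \<le> 4 * (n * (2 * t - 1)) + n" by linarith
      also have "\<dots> = (4 * (2 * t - 1) + 1) * n" by (simp add: algebra_simps)
      also have "4 * (2 * t - 1) + 1 = 8 * t - 3" using t2 by simp
      finally show ?thesis .
    qed
    have "card Orb = (\<Sum>r\<in>S. \<Sum>y\<in>Y. card (nbrs H {r, y} \<inter> S))"
      unfolding Orb_def using finS finite_Y by (simp add: card_SigmaI)
    then have "4 * card Orb = (\<Sum>r\<in>S. 4 * (\<Sum>y\<in>Y. card (nbrs H {r, y} \<inter> S)))"
      by (simp add: sum_distrib_left)
    also have "\<dots> \<le> card S * ((8 * t - 3) * n)"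
      using sum_bounded_above[of S "\<lambda>r. 4 * (\<Sum>y\<in>Y. card (nbrs H {r, y} \<inter> S))" "(8 * t - 3) * n"] each by simp
    finally show ?thesis by (simp add: k_def)
  qed
  have cX2: "2 * card X2 \<le> card Orb"
  proof -
    have "\<exists>r u y. e = {r, y, u} \<and> r \<in> S \<and> u \<in> S \<and> r \<noteq> u \<and> y \<in> Y" if e: "e \<in> X2" for e
    proof -
      have eX: "e \<in> X" "e \<in> H" using e by (auto simp: X2_def X_def)
      obtain y where y: "y \<in> e" "y \<in> Y" using e by (auto simp: X2_def)
      obtain P where P: "P \<subseteq> e \<inter> S" "card P = 2" using XS[OF eX(1)] by (metis obtain_subset_with_card_n)
      then obtain r u where ru: "P = {r, u}" "r \<noteq> u" by (auto simp: card_2_iff)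
      have yS: "y \<notin> S" using y S_sub by (auto simp: Y_def)
      have "{r, y, u} \<subseteq> e" using P ru y by auto
      moreover have "r \<noteq> y" "u \<noteq> y" using ru yS P by auto
      then have "card {r, y, u} = 3" using ru(2) by simp
      ultimately have "e = {r, y, u}"
        using card_subset_eq[OF finite_edge[OF eX(2)]] edgeD(2)[OF eX(2)] by metis
      then show ?thesis using P ru y by auto
    qed
    then obtain r u y where ruy: "\<And>e. e \<in> X2 \<Longrightarrow> {r e, y e, u e} = e \<and> r e \<in> S \<and> u e \<in> S \<and> r e \<noteq> u e \<and> y e \<in> Y"
      by metis
    define g where "g = (\<lambda>(e, c). if c then (r e, y e, u e) else (u e, y e, r e))"
    have "card (X2 \<times> (UNIV :: bool set)) \<le> card Orb"
    proof (rule card_inj_on_le[where f = g])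
      show "inj_on g (X2 \<times> UNIV)"
      proof (rule inj_onI)
        fix a a' assume a: "a \<in> X2 \<times> UNIV" "a' \<in> X2 \<times> UNIV" "g a = g a'"
        have recover: "(\<lambda>(p, q, s). {p, q, s}) (g x) = fst x" if "x \<in> X2 \<times> UNIV" for x
        proof (cases x)
          case (Pair e c)
          then have "{r e, y e, u e} = e" using ruy that by auto
          moreover have "{u e, y e, r e} = {r e, y e, u e}" by auto
          ultimately show ?thesis using Pair by (simp add: g_def)
        qed
        have "fst a = fst a'" using recover[OF a(1)] recover[OF a(2)] a(3) by simp
        moreover have "r (fst a) \<noteq> u (fst a)" using ruy a(1) by auto
        then have "snd a = snd a'" using a(3) \<open>fst a = fst a'\<close> unfolding g_def
          by (cases a; cases a') (auto split: if_splits)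
        ultimately show "a = a'" by (rule prod_eqI)
      qed
      show "g ` (X2 \<times> UNIV) \<subseteq> Orb"
      proof
        fix w assume "w \<in> g ` (X2 \<times> UNIV)"
        then obtain e c where e: "e \<in> X2" "w = g (e, c)" by auto
        have *: "r e \<in> S" "u e \<in> S" "y e \<in> Y" "{r e, y e, u e} = e" using ruy[OF e(1)] by auto
        then have "{r e, y e, u e} \<in> H" using e(1) by (auto simp: X2_def X_def)
        then have "u e \<in> nbrs H {r e, y e}" "r e \<in> nbrs H {u e, y e}"
          by (simp_all add: in_nbrs insert_commute)
        then show "w \<in> Orb" using * e(2) by (cases c) (auto simp: g_def Orb_def)
      qed
    qed (rule finOrb)
    then show ?thesis by (simp add: card_cartesian_product mult.commute)
  qed
  \<comment> \<open>A triple \<open>{s, r, y}\<close> with \<open>r\<close> in \<open>R s\<close>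
    and \<open>y\<close> outside \<open>T\<close> and \<open>R s\<close> determines
    \<open>s\<close>, \<open>r\<close> and \<open>y\<close>, so nothing is counted twice. At most
    \<open>5 * t + 1\<close> of these triples per choice of \<open>s\<close> and \<open>r\<close>
    are edges.\<close>
  have cT': "card (H - X) + t * (k * (n - t - k)) \<le> card (star n T) + t * (k * (5 * t + 1))"
  proof -
    have "\<exists>R. R \<subseteq> thin s \<and> card R = k" if "s \<in> T" for s
      using s0(2)[OF that] unfolding k_def S_def by (metis obtain_subset_with_card_n)
    then obtain R where R: "\<And>s. s \<in> T \<Longrightarrow> R s \<subseteq> thin s \<and> card (R s) = k" by metis
    have RT: "R s \<inter> T = {}" "R s \<subseteq> {..<n}" "finite (R s)" if "s \<in> T" for s
      using R[OF that] thin_T thin_sub finite_subset[of "R s" "{..<n}"] by blast+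
    define B where "B = Sigma T (\<lambda>s. R s \<times> ({..<n} - T - R s))"
    define \<phi> where "\<phi> = (\<lambda>(s, r, y). {s, r, y :: nat})"
    have finB: "finite B" using finT RT(3) by (auto simp: B_def)
    have cB: "card B = t * (k * (n - t - k))"
    proof -
      have "card (R s \<times> ({..<n} - T - R s)) = k * (n - t - k)" if s: "s \<in> T" for s
      proof -
        have "card ({..<n} - T) = n - t" using T_sub finT cT by (simp add: card_Diff_subset)
        moreover have "card ({..<n} - T - R s) = card ({..<n} - T) - card (R s)"
          by (rule card_Diff_subset) (use RT[OF s] in auto)
        ultimately show ?thesis using R[OF s] by (simp add: card_cartesian_product)
      qed
      then show ?thesis unfolding B_def using finT RT(3) cT by (simp add: card_SigmaI)
    qed
    have inj: "inj_on \<phi> B"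
    proof (rule inj_onI)
      fix a a' assume a: "a \<in> B" "a' \<in> B" "\<phi> a = \<phi> a'"
      obtain s r y where x: "a = (s, r, y)" by (cases a)
      obtain s' r' y' where x': "a' = (s', r', y')" by (cases a')
      have m: "s \<in> T" "r \<in> R s" "y \<notin> T" "y \<notin> R s" "s' \<in> T" "r' \<in> R s'" "y' \<notin> T" "y' \<notin> R s'"
        using a x x' by (auto simp: B_def)
      have rT: "r \<notin> T" "r' \<notin> T" using RT(1) m by blast+
      have eq: "{s, r, y} = {s', r', y'}" using a(3) x x' by (simp add: \<phi>_def)
      then have "{s, r, y} \<inter> T = {s', r', y'} \<inter> T" by simp
      then have s: "s = s'" using m rT by auto
      have "{s, r, y} \<inter> R s = {s', r', y'} \<inter> R s" using eq by simp
      moreover have "s \<notin> R s" using RT(1) m(1) by blast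
      ultimately have r: "r = r'" using m s by auto
      have "{s, r, y} - {s, r} = {s', r', y'} - {s', r'}" using eq s r by simp
      moreover have "y \<noteq> s" "y \<noteq> r" "y' \<noteq> s'" "y' \<noteq> r'" using m by auto
      ultimately have "y = y'" by auto
      then show "a = a'" using x x' s r by simp
    qed
    have img: "\<phi> ` B \<subseteq> star n T"
    proof
      fix e assume "e \<in> \<phi> ` B"
      then obtain s r y where m: "s \<in> T" "r \<in> R s" "y < n" "y \<notin> T" "y \<notin> R s" "e = {s, r, y}"
        by (auto simp: B_def \<phi>_def)
      have r: "r \<notin> T" "r < n" using RT[OF m(1)] m(2) by auto
      have "s \<noteq> r" "s \<noteq> y" "r \<noteq> y" using m r by auto
      then have "card {s, r, y} = 3" by simp
      then show "e \<in> star n T" using m r T_sub by (auto simp: star_def)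
    qed
    have cBH: "card (\<phi> ` B \<inter> H) \<le> t * (k * (5 * t + 1))"
    proof -
      let ?D = "Sigma T (\<lambda>s. Sigma (R s) (\<lambda>r. nbrs H {s, r}))"
      have finD: "finite ?D" using finT RT(3) finite_nbrs by auto
      have "\<phi> ` B \<inter> H \<subseteq> \<phi> ` ?D"
      proof
        fix e assume e: "e \<in> \<phi> ` B \<inter> H"
        then obtain s r y where m: "s \<in> T" "r \<in> R s" "e = {s, r, y}" by (auto simp: B_def \<phi>_def)
        then have "y \<in> nbrs H {s, r}" using e by (simp add: in_nbrs)
        then show "e \<in> \<phi> ` ?D" using m by (intro image_eqI[where x = "(s, r, y)"]) (auto simp: \<phi>_def)
      qed
      then have "card (\<phi> ` B \<inter> H) \<le> card ?D"
        by (intro order_trans[OF card_mono card_image_le[OF finD]]) (use finD in auto)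
      also have "\<dots> = (\<Sum>s\<in>T. \<Sum>r\<in>R s. cd {s, r})"
        using finT RT(3) finite_nbrs by (simp add: card_SigmaI)
      also have "\<dots> \<le> (\<Sum>s\<in>T. k * (5 * t + 1))"
      proof (rule sum_mono)
        fix s assume s: "s \<in> T"
        have "cd {s, r} \<le> 5 * t + 1" if "r \<in> R s" for r using R[OF s] that by (auto simp: thin_def)
        then have "(\<Sum>r\<in>R s. cd {s, r}) \<le> card (R s) * (5 * t + 1)"
          using sum_bounded_above[of "R s" "\<lambda>r. cd {s, r}" "5 * t + 1"] by simp
        then show "(\<Sum>r\<in>R s. cd {s, r}) \<le> k * (5 * t + 1)" using R[OF s] by simp
      qed
      also have "\<dots> = t * (k * (5 * t + 1))" using cT by simp
      finally show ?thesis .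
    qed
    have "H - X \<subseteq> star n T" using edgeD by (auto simp: X_def star_def)
    then have "card ((H - X) \<union> (\<phi> ` B - H)) \<le> card (star n T)"
      using img by (intro card_mono[OF finite_star]) auto
    moreover have "card ((H - X) \<union> (\<phi> ` B - H)) = card (H - X) + card (\<phi> ` B - H)"
      by (rule card_Un_disjoint) (use finite_H finB in auto)
    moreover have "card (\<phi> ` B) = card (\<phi> ` B \<inter> H) + card (\<phi> ` B - H)"
      by (rule card_Int_Diff) (use finB in simp)
    ultimately show ?thesis using cBH card_image[OF inj] cB by linarith
  qed
  \<comment> \<open>The balance per thin vertex, scaled by 8: the gap of \<open>3 * n\<close>
    between \<open>(8 * t - 3) * n\<close> and \<open>8 * t * n\<close> absorbs the terms
    independent of \<open>n\<close>.\<close>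
  have unit: "8 * (k0 * k0) + 8 * (t * (5 * t + 1)) + (8 * t - 3) * n \<le> 8 * (t * (n - t - k))"
  proof -
    define N where "N = n - t - k"
    have nN: "n = N + t + k" using n(2) kk0 by (simp add: N_def k0_def)
    have "(8 * t - 3) * n + 3 * n = 8 * (t * n)" using t2 by (simp add: diff_mult_distrib)
    moreover have "8 * (t * n) = 8 * (t * N) + 8 * (t * t) + 8 * (t * k)" unfolding nN by (simp add: algebra_simps)
    moreover have "t * k \<le> t * k0" using kk0 by simp
    moreover have "8 * (k0 * k0) + 8 * (t * (5 * t + 1)) + 8 * (t * t) + 8 * (t * k0) \<le> n"
      using n(2) unfolding k0_def by linarith
    ultimately show ?thesis unfolding N_def[symmetric] by linarith
  qed
  have "8 * (card X1 + card X2 + t * (k * (5 * t + 1))) \<le> 8 * (t * (k * (n - t - k)))"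
  proof -
    have "8 * (card X1 + card X2 + t * (k * (5 * t + 1)))
      \<le> 8 * (k * (k0 * k0)) + k * ((8 * t - 3) * n) + 8 * (t * (k * (5 * t + 1)))"
    proof -
      have "8 * card X1 \<le> 8 * (k * (k0 * k0))" using cX1 by (rule mult_le_mono2)
      moreover have "8 * card X2 \<le> 4 * card Orb" using cX2 by simp
      then have "8 * card X2 \<le> k * ((8 * t - 3) * n)" using cOrb by (rule le_trans)
      ultimately show ?thesis unfolding distrib_left by (intro add_mono order_refl)
    qed
    also have "\<dots> = k * (8 * (k0 * k0) + 8 * (t * (5 * t + 1)) + (8 * t - 3) * n)"
      by (simp only: distrib_left ac_simps)
    also have "\<dots> \<le> k * (8 * (t * (n - t - k)))" by (rule mult_le_mono2[OF unit])
    also have "\<dots> = 8 * (t * (k * (n - t - k)))" by (simp only: ac_simps)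
    finally show ?thesis .
  qed
  moreover define p q where "p = t * (k * (5 * t + 1))" and "q = t * (k * (n - t - k))"
  ultimately have "card X1 + card X2 + p \<le> q" by simp
  moreover have "card H = card (H - X) + card X"
    using card_Int_Diff[OF finite_H, of X] by (simp add: X_def Int_def)
  moreover have "card X = card X1 + card X2"
    using card_Int_Diff[OF finX(1), of X2] by (simp add: X1_def X2_def Int_def)
  ultimately have "card H \<le> card (star n T)" 
    using cT'[folded p_def q_def] by linarith
  then show ?thesis using card_star[OF T_sub] cT by simp
qed

end

theorem theorem1:
  fixes t :: nat
  assumes "t > 1"
  shows "\<exists>n0. \<forall>n\<ge>n0. ex 3 n (expansion 3 (fan t)) = (n choose 3) - ((n - t) choose 3)"
proof -
  define K where "K = exc_const t"
  define b where "b = core_const K"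
  \<comment> \<open>This value depends only on \<open>t\<close>, \<open>K\<close> and
    \<open>b\<close>, so it can be fixed before \<open>n\<close> and \<open>H\<close>.\<close>
  define c where "c = fan_free_core.thin_const t K b"
  define n0 where "n0 = t + core_bound t K + b * core_min t + 4 * c * (4 * t * (4 * (K * (4 * c)) + 1))
    + (8 * (c * c) + 8 * (t * (5 * t + 1)) + 8 * (t * t) + 8 * (t * c) + t + c)"
  have "ex 3 n (expansion 3 (fan t)) = (n choose 3) - ((n - t) choose 3)" if "n \<ge> n0" for n
  proof -
    have n: "t \<le> n" "core_bound t K \<le> n" "b * core_min t \<le> n" "4 * c * (4 * t * (4 * (K * (4 * c)) + 1)) \<le> n"
      "8 * (c * c) + 8 * (t * (5 * t + 1)) + 8 * (t * t) + 8 * (t * c) + t + c \<le> n"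
      using that unfolding n0_def by linarith+
    let ?S = "{card H | H. H \<in> rgraphs 3 n \<and> \<not> contains H (expansion 3 (fan t))}"
    have upper: "card H \<le> (n choose 3) - ((n - t) choose 3)"
      if H: "H \<in> rgraphs 3 n" "\<not> contains H (expansion 3 (fan t))" for H
    proof (rule ccontr)
      assume big: "\<not> ?thesis"
      interpret fan_free H n t by unfold_locales (use assms H in auto)
      \<comment> \<open>A counterexample exceeds the star in size, which is the density needed for
        \<open>card_exc_le\<close>.\<close>
      have exc: "card {(a, b). exc a b} \<le> K * n"
        unfolding K_def by (rule card_exc_le[OF n(1)]) (use big in simp)
      obtain T A where TA: "card T = t" "A \<subseteq> {..<n}" "n \<le> b * card A"
        "\<forall>q\<in>A. \<forall>q'\<in>A. q \<noteq> q' \<longrightarrow> nbrs H {q, q'} = T"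
        using core_exists[OF exc n(2)] unfolding b_def by blast
      have "b * core_min t \<le> b * card A" using n(3) TA(3) by linarith
      moreover have "0 < b" by (simp add: b_def core_const_def core_sparse_def)
      ultimately have "core_min t \<le> card A" by simp
      then interpret fan_free_core H n t T A K b by unfold_locales (use TA exc in auto)
      show False using card_H_le n(4,5) big unfolding c_def by simp
    qed
    have "?S \<subseteq> {..(n choose 3) - ((n - t) choose 3)}" using upper by auto
    then have "finite ?S" using finite_subset by blast
    moreover have "(n choose 3) - ((n - t) choose 3) \<in> ?S"
    proof -
      have "star n {..<t} \<in> rgraphs 3 n" by (auto simp: rgraphs_def star_def)
      moreover have "card (star n {..<t}) = (n choose 3) - ((n - t) choose 3)"
        using card_star[of "{..<t}" n] n(1) by simp
      moreover have "\<not> contains (star n {..<t}) (expansion 3 (fan t))" by (rule star_fan_free) (use assms in simp)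
      ultimately show ?thesis by (metis (mono_tags, lifting) mem_Collect_eq)
    qed
    ultimately show ?thesis unfolding ex_def by (intro Max_eqI) (use upper in auto)
  qed
  then show ?thesis by blast
qed

end
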